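(* Let $N\ge 1$, $d\ge 2$ be integers and let $\boldsymbol p=(p_1,\dots,p_d)$ with $p_j>0$, $\sum_j p_j=1$. Let $Q_n(\boldsymbol x,\boldsymbol y;N,\boldsymbol p)$, $n=0,\dots,N$, be the reproducing kernel polynomials on the multinomial $(N,\boldsymbol p)$ distribution. For $\boldsymbol x,\boldsymbol y\in\mathbb Z_+^d$ with $|\boldsymbol x|=|\boldsymbol y|=N$: (a) For real $\rho$, $$1+\sum_{n=1}^N\rho^nQ_n(\boldsymbol x,\boldsymbol y;N,\boldsymbol p)=m(\boldsymbol x;N,\boldsymbol p)^{-1}m(\boldsymbol y;N,\boldsymbol p)^{-1}\sum_{\boldsymbol z\le\boldsymbol x,\boldsymbol y}\rho^{|\boldsymbol z|}(1-\rho)^{N-|\boldsymbol z|}\binom{N}{\boldsymbol z,\,N-|\boldsymbol z|}\prod_{i=1}^dp_i^{z_i}\;\binom{N-|\boldsymbol z|}{\boldsymbol x-\boldsymbol z}\prod_{i=1}^dp_i^{x_i-z_i}\;\binom{N-|\boldsymbol z|}{\boldsymbol y-\boldsymbol z}\prod_{i=1}^dp_i^{y_i-z_i},$$ and this is non-negative if $$-\frac{1}{\frac{1}{\min_ip_i}-1}\le\rho\le1.$$ (b) For $0\le n\le N$, $$Q_n(\boldsymbol x,\boldsymbol y;N,\boldsymbol p)=\sum_{\boldsymbol z\le\boldsymbol x,\boldsymbol y:\ |\boldsymbol z|\le n}\binom{N}{|\boldsymbol z|}\binom{N-|\boldsymbol z|}{n-|\boldsymbol z|}(-1)^{n-|\boldsymbol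 z|}\binom{|\boldsymbol z|}{\boldsymbol z}\frac{\prod_{j=1}^d (x_j)_{[z_j]}(y_j)_{[z_j]}p_j^{-z_j}}{\left(N_{[|\boldsymbol z|]}\right)^2}.$$ (c) If $\boldsymbol X,\boldsymbol Y$ are independent multinomial $(N,\boldsymbol p)$ vectors, then for $0\le n\le N$, $$\mathbb E\Big[\prod_{i=1}^ds_i^{X_i}\prod_{j=1}^dt_j^{Y_j}\,Q_n(\boldsymbol X,\boldsymbol Y;N,\boldsymbol p)\Big]=\binom Nn\big[T_0(\boldsymbol s)T_0(\boldsymbol t)\big]^{N-n}\Big[\sum_{j=1}^dp_js_jt_j-T_0(\boldsymbol s)T_0(\boldsymbol t)\Big]^n,$$ where $T_0(\boldsymbol s)=\sum_{i=1}^ds_ip_i$ and $T_0(\boldsymbol t)=\sum_{i=1}^dt_ip_i$.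
   Context: Notation: $|\boldsymbol x|=\sum_jx_j$; $\boldsymbol z\le\boldsymbol x,\boldsymbol y$ means $\boldsymbol z\in\mathbb Z_+^d$ with $z_j\le x_j$ and $z_j\le y_j$ for all $j$; $x_{[k]}=x(x-1)\cdots(x-k+1)$, $x_{[0]}=1$; $\binom{k}{\boldsymbol z}=k!/\prod_jz_j!$ when $|\boldsymbol z|=k$, and $\binom{N}{\boldsymbol z,N-|\boldsymbol z|}=N!/(\prod_jz_j!\,(N-|\boldsymbol z|)!)$; $0^0=1$. The multinomial probability is $m(\boldsymbol x;N,\boldsymbol p)=\binom N{\boldsymbol x}\prod_jp_j^{x_j}$ for $\boldsymbol x\in\mathbb Z_+^d$, $|\boldsymbol x|=N$. Reproducing kernel polynomials: choose real functions $u^{(0)}\equiv1,u^{(1)},\dots,u^{(d-1)}$ on $\{1,\dots,d\}$ that are orthonormal with respect to $\boldsymbol p$, i.e. $\sum_{j=1}^du^{(k)}_ju^{(l)}_jp_j=\delta_{kl}$. For $\boldsymbol n=(n_1,\dots,n_{d-1})\in\mathbb Z_+^{d-1}$ with $|\boldsymbol n|\le N$ let $Q_{\boldsymbol n}(\boldsymbol x;\boldsymbol u)$ be the coefficient of $w_1^{n_1}\cdots w_{d-1}^{n_{d-1}}$ in $\prod_{j=1}^d\big(1+\sum_{l=1}^{d-1}w_lu_j^{(l)}\big)^{x_j}$. These (multivariate Krawtchouk polynomials) are orthogonal on the multinomial $(N,\boldsymbol p)$ distribution with $\mathbb E[Q_{\boldsymbol n}(\boldsymbol X;\boldsymbol u)^2]=\binom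 N{\boldsymbol n,N-|\boldsymbol n|}$. Put $Q^\circ_{\boldsymbol n}=\binom N{\boldsymbol n,N-|\boldsymbol n|}^{-1/2}Q_{\boldsymbol n}$ and define $Q_n(\boldsymbol x,\boldsymbol y;N,\boldsymbol p)=\sum_{|\boldsymbol n|=n}Q^\circ_{\boldsymbol n}(\boldsymbol x;\boldsymbol u)Q^\circ_{\boldsymbol n}(\boldsymbol y;\boldsymbol u)$, which does not depend on the choice of $\boldsymbol u$. *)

theory Defs
  imports "HOL-Probability.Probability" "HOL-Library.Poly_Mapping"
begin

(* The finite type 'd is the index set {1, ..., d}, so d = CARD('d).  A vector in Z_+^d is a
   function 'd => nat, ordered componentwise and with componentwise subtraction. *)

definition vsum :: "('d::finite \<Rightarrow> nat) \<Rightarrow> nat" where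
  "vsum x = (\<Sum>j\<in>UNIV. x j)"

definition falling :: "nat \<Rightarrow> nat \<Rightarrow> real" where
  "falling x k = (\<Prod>i<k. (real x - real i))"

(* Only meant for vsum z = k. *)
definition multinom :: "nat \<Rightarrow> ('d::finite \<Rightarrow> nat) \<Rightarrow> real" where
  "multinom k z = fact k / (\<Prod>j\<in>UNIV. fact (z j))"

(* Only meant for vsum z \<le> N: the multinomial coefficient with parts z_1, ..., z_d, N - |z|. *)
definition multinom_rest :: "nat \<Rightarrow> ('d::finite \<Rightarrow> nat) \<Rightarrow> real" where
  "multinom_rest N z = fact N / ((\<Prod>j\<in>UNIV. fact (z j)) * fact (N - vsum z))"

(* Only meant for vsum x = N. *)
definition multinomial_prob :: "nat \<Rightarrow> ('d::finite \<Rightarrow> real) \<Rightarrow> ('d \<Rightarrow> nat) \<Rightarrow> real" where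
  "multinomial_prob N p x = multinom N x * (\<Prod>j\<in>UNIV. p j ^ x j)"

definition multinomial_distributed ::
  "'w measure \<Rightarrow> nat \<Rightarrow> ('d::finite \<Rightarrow> real) \<Rightarrow> ('w \<Rightarrow> 'd \<Rightarrow> nat) \<Rightarrow> bool" where
  "multinomial_distributed M N p X \<longleftrightarrow>
     distributed M (count_space UNIV) X
       (\<lambda>x. ennreal (if vsum x = N then multinomial_prob N p x else 0))"

(* u k j is u^(k)_j; only k < CARD('d) matters. *)
definition orthonormal_system :: "('d::finite \<Rightarrow> real) \<Rightarrow> (nat \<Rightarrow> 'd \<Rightarrow> real) \<Rightarrow> bool" where
  "orthonormal_system p u \<longleftrightarrow>
     (\<forall>j. u 0 j = 1) \<and>
     (\<forall>k<CARD('d). \<forall>l<CARD('d).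
        (\<Sum>j\<in>UNIV. u k j * u l j * p j) = (if k = l then 1 else 0))"

(* Polynomials in the variables w_1, w_2, ... are finitely supported functions on exponent
   vectors, and the ring operations of poly_mapping are those of polynomials. *)

type_synonym multiindex = "nat \<Rightarrow>\<^sub>0 nat"

definition wvar :: "nat \<Rightarrow> multiindex \<Rightarrow>\<^sub>0 real" where
  "wvar l = Poly_Mapping.single (Poly_Mapping.single l 1) 1"

definition const_poly :: "real \<Rightarrow> multiindex \<Rightarrow>\<^sub>0 real" where
  "const_poly c = Poly_Mapping.single 0 c"

definition krawtchouk_gen :: "(nat \<Rightarrow> 'd::finite \<Rightarrow> real) \<Rightarrow> ('d \<Rightarrow> nat) \<Rightarrow> (multiindex \<Rightarrow>\<^sub>0 real)" where
  "krawtchouk_gen u x =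
     (\<Prod>j\<in>UNIV. (1 + (\<Sum>l\<in>{1..<CARD('d)}. wvar l * const_poly (u l j))) ^ x j)"

definition krawtchouk :: "(nat \<Rightarrow> 'd::finite \<Rightarrow> real) \<Rightarrow> multiindex \<Rightarrow> ('d \<Rightarrow> nat) \<Rightarrow> real" where
  "krawtchouk u n x = Poly_Mapping.lookup (krawtchouk_gen u x) n"

(* Multi-indices in Z_+^(r - 1) with coordinates 1, ..., r - 1 and coordinate sum m. *)
definition multiindices :: "nat \<Rightarrow> nat \<Rightarrow> multiindex set" where
  "multiindices r m =
     {n. Poly_Mapping.keys n \<subseteq> {1..<r} \<and> (\<Sum>l\<in>{1..<r}. Poly_Mapping.lookup n l) = m}"

(* The squared norm of krawtchouk u n under the multinomial (N, p) distribution. *)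
definition krawtchouk_norm2 :: "nat \<Rightarrow> nat \<Rightarrow> multiindex \<Rightarrow> real" where
  "krawtchouk_norm2 r N n =
     fact N / ((\<Prod>l\<in>{1..<r}. fact (Poly_Mapping.lookup n l)) *
               fact (N - (\<Sum>l\<in>{1..<r}. Poly_Mapping.lookup n l)))"

definition krawtchouk_normalized ::
  "nat \<Rightarrow> (nat \<Rightarrow> 'd::finite \<Rightarrow> real) \<Rightarrow> multiindex \<Rightarrow> ('d \<Rightarrow> nat) \<Rightarrow> real" where
  "krawtchouk_normalized N u n x = krawtchouk u n x / sqrt (krawtchouk_norm2 CARD('d) N n)"

(* Q_n(x, y; N, p); the dependence on p is through the choice of u. *)
definition kernel_poly ::
  "nat \<Rightarrow> (nat \<Rightarrow> 'd::finite \<Rightarrow> real) \<Rightarrow> nat \<Rightarrow> ('d \<Rightarrow> nat) \<Rightarrow> ('d \<Rightarrow> nat) \<Rightarrow> real" where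
  "kernel_poly N u n x y =
     (\<Sum>k\<in>multiindices CARD('d) n. krawtchouk_normalized N u k x * krawtchouk_normalized N u k y)"

lemma finite_multiindices: "finite (multiindices r m)"
proof -
  have "Poly_Mapping.lookup ` multiindices r m \<subseteq>
    {f. \<forall>i. (i \<in> {1..<r} \<longrightarrow> f i \<in> {..m}) \<and> (i \<notin> {1..<r} \<longrightarrow> f i = 0)}"
  proof clarify
    fix n i assume n: "n \<in> multiindices r m"
    have "Poly_Mapping.lookup n i \<le> m" if "i \<in> {1..<r}"
      using n member_le_sum[of i "{1..<r}" "Poly_Mapping.lookup n"] that
      by (auto simp: multiindices_def)
    moreover have "Poly_Mapping.lookup n i = 0" if "i \<notin> {1..<r}"
      using n that by (force simp: multiindices_def in_keys_iff)
    ultimately show "(i \<in> {1..<r} \<longrightarrow> Poly_Mapping.lookup n i \<in> {..m}) \<and>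
        (i \<notin> {1..<r} \<longrightarrow> Poly_Mapping.lookup n i = 0)" by auto
  qed
  then have "finite (Poly_Mapping.lookup ` multiindices r m)"
    by (rule finite_subset) (rule finite_set_of_finite_funs, auto)
  then show ?thesis
    by (rule finite_imageD) (auto simp: inj_on_def poly_mapping_eqI)
qed

(* Orthonormal systems exist, so quantifying over all of them is not vacuous. *)
lemma orthonormal_system_exists:
  fixes p :: "'d::finite \<Rightarrow> real"
  assumes pos: "\<And>j. p j > 0" and sum1: "(\<Sum>j\<in>UNIV. p j) = 1"
  shows "\<exists>u. orthonormal_system p u"
proof -
  let ?d = "CARD('d)"
  obtain e :: "nat \<Rightarrow> 'd" where e: "bij_betw e {0..<?d} UNIV"
    using ex_bij_betw_nat_finite[OF finite[of "UNIV :: 'd set"]] by blast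
  define f where "f = inv_into {0..<?d} e"
  have fe: "f (e i) = i" if "i < ?d" for i
    using e that by (simp add: f_def bij_betw_inv_into_left)
  define q where "q i = p (e i)" for i
  have reindex: "(\<Sum>j\<in>UNIV. g j) = (\<Sum>i<?d. g (e i))" for g :: "'d \<Rightarrow> real"
    using sum.reindex_bij_betw[OF e, of g] by (simp add: atLeast0LessThan)
  define P where "P k = (\<Sum>i<k. q i)" for k
  have q0: "q i > 0" for i using pos by (simp add: q_def)
  have P0: "P k > 0" if "k > 0" for k
    unfolding P_def using that q0 by (intro sum_pos) auto
  define a where "a k = 1 / sqrt (1 / P k + 1 / q k)" for k
  have a2: "a k * a k * (1 / P k + 1 / q k) = 1" if "k > 0" for k
  proof -
    have "1 / P k + 1 / q k > 0" using P0[OF that] q0[of k] by (simp add: add_pos_pos)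
    then show ?thesis by (simp add: a_def)
  qed
  define v :: "nat \<Rightarrow> nat \<Rightarrow> real" where
    "v k i = (if k = 0 then 1 else if i < k then a k / P k else if i = k then - a k / q k else 0)" for k i
  have split: "(\<Sum>i<?d. g i) = (\<Sum>i<k. g i) + g k"
    if "k < ?d" "\<And>i. i > k \<Longrightarrow> g i = 0" for k and g :: "nat \<Rightarrow> real"
  proof -
    have "(\<Sum>i<?d. g i) = (\<Sum>i<Suc k. g i)"
      using that by (intro sum.mono_neutral_right) auto
    then show ?thesis by simp
  qed
  have zero: "(\<Sum>i<?d. v k i * q i) = 0" if "0 < k" "k < ?d" for k
  proof -
    have "(\<Sum>i<?d. v k i * q i) = (\<Sum>i<k. v k i * q i) + v k k * q k"
      using that by (intro split) (auto simp: v_def)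
    also have "(\<Sum>i<k. v k i * q i) = a k / P k * P k"
      using that by (simp add: v_def P_def sum_distrib_left)
    finally show ?thesis using P0[of k] q0[of k] that by (simp add: v_def)
  qed
  have norm: "(\<Sum>i<?d. v k i * v k i * q i) = 1" if "0 < k" "k < ?d" for k
  proof -
    have "(\<Sum>i<?d. v k i * v k i * q i) = (\<Sum>i<k. v k i * v k i * q i) + v k k * v k k * q k"
      using that by (intro split) (auto simp: v_def)
    also have "(\<Sum>i<k. v k i * v k i * q i) = a k / P k * (a k / P k) * P k"
      using that by (simp add: v_def P_def sum_distrib_left)
    also have "\<dots> + v k k * v k k * q k = a k * a k * (1 / P k + 1 / q k)"
      using P0[of k] q0[of k] that by (simp add: v_def field_simps)
    finally show ?thesis using a2 that by simp
  qed
  have orth: "(\<Sum>i<?d. v k i * v l i * q i) = 0" if "l < k" "k < ?d" for k l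
  proof (cases "l = 0")
    case True
    then show ?thesis using zero[of k] that by (simp add: v_def)
  next
    case False
    have "(\<Sum>i<?d. v k i * v l i * q i) = (\<Sum>i<?d. a k / P k * (v l i * q i))"
      using that False by (intro sum.cong) (auto simp: v_def mult_ac)
    also have "\<dots> = 0"
      unfolding sum_distrib_left[symmetric] using zero[of l] that False by simp
    finally show ?thesis .
  qed
  have one: "(\<Sum>i<?d. q i) = 1"
    using sum1 reindex[of p] by (simp add: q_def)
  have "orthonormal_system p (\<lambda>k j. v k (f j))"
    unfolding orthonormal_system_def
  proof (intro conjI allI impI)
    fix k l assume kl: "k < ?d" "l < ?d"
    have "(\<Sum>j\<in>UNIV. v k (f j) * v l (f j) * p j) = (\<Sum>i<?d. v k i * v l i * q i)"
      unfolding reindex by (intro sum.cong) (auto simp: fe q_def)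
    also have "\<dots> = (if k = l then 1 else 0)"
    proof (cases k l rule: linorder_cases)
      case less
      then show ?thesis using orth[of k l] kl by (simp add: mult.commute)
    next
      case equal
      then show ?thesis using norm[of k] one kl by (cases "k = 0") (auto simp: v_def)
    next
      case greater
      then show ?thesis using orth[of l k] kl by simp
    qed
    finally show "(\<Sum>j\<in>UNIV. v k (f j) * v l (f j) * p j) = (if k = l then 1 else 0)" .
  qed (simp add: v_def)
  then show ?thesis by blast
qed

end

theory Submission
  imports Defs
begin

text \<open>
  Write \<open>S = (\<Sum>j. s j * p j)\<close>, \<open>T = (\<Sum>j. t j * p j)\<close> and \<open>P = (\<Sum>j. p j * s j * t j)\<close>. By the multinomial
  theorem, weighting the Krawtchouk polynomials by \<open>m(x) s\<^sup>x\<close> and summing over \<open>x\<close> gives the coefficients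
  of \<open>(\<Sum>j. p j * s j * (1 + (\<Sum>l. w l * u l j))) ^ N\<close>, so Parseval's identity for the orthonormal
  system turns the generating function of \<open>m(x) m(y) Q\<^sub>n(x, y)\<close> into
  \<open>(N choose n) * (S * T) ^ (N - n) * (P - S * T) ^ n\<close>, which is part (c). Summed against \<open>\<rho> ^ n\<close> this is
  \<open>(\<rho> * P + (1 - \<rho>) * (S * T)) ^ N\<close>. The monomials in \<open>s\<close> and \<open>t\<close> are linearly independent, so
  expanding in powers of \<open>P\<close> and \<open>S * T\<close> and comparing coefficients gives (a) and (b), and
  non-negativity holds because the bilinear form \<open>\<rho> * P + (1 - \<rho>) * (S * T)\<close> has non-negative
  coefficients.
\<close>

section \<open>Multinomial theorem and comparison of coefficients\<close>

lemma sum_swap_outer: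
  "(\<Sum>x\<in>A. \<Sum>y\<in>B. \<Sum>k\<in>K. f k x y) = (\<Sum>k\<in>K. \<Sum>x\<in>A. \<Sum>y\<in>B. f k x y)"
proof -
  have "(\<Sum>x\<in>A. \<Sum>y\<in>B. \<Sum>k\<in>K. f k x y) = (\<Sum>x\<in>A. \<Sum>k\<in>K. \<Sum>y\<in>B. f k x y)"
    by (intro sum.cong refl sum.swap)
  also have "\<dots> = (\<Sum>k\<in>K. \<Sum>x\<in>A. \<Sum>y\<in>B. f k x y)"
    by (rule sum.swap)
  finally show ?thesis .
qed

text \<open>Forcing \<open>k\<close> to be 0 off \<open>I\<close> makes it determined by its values
  on \<open>I\<close>. For finite \<open>I\<close> the set is therefore finite, and each exponent
  vector occurs once.\<close>

definition compositions :: "'i set \<Rightarrow> nat \<Rightarrow> ('i \<Rightarrow> nat) set" where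
  "compositions I N = {k. (\<forall>i. i \<notin> I \<longrightarrow> k i = 0) \<and> (\<Sum>i\<in>I. k i) = N}"

lemma finite_compositions:
  assumes "finite I"
  shows "finite (compositions I N)"
proof (rule finite_subset)
  show "compositions I N \<subseteq> {f. \<forall>i. (i \<in> I \<longrightarrow> f i \<in> {..N}) \<and> (i \<notin> I \<longrightarrow> f i = 0)}"
    using assms member_le_sum[of _ I] by (fastforce simp: compositions_def)
  show "finite {f. \<forall>i. (i \<in> I \<longrightarrow> f i \<in> {..N}) \<and> (i \<notin> I \<longrightarrow> f i = 0)}"
    by (rule finite_set_of_finite_funs) (use assms in auto)
qed

lemma compositions_UNIV: "compositions UNIV N = {x. vsum x = N}"
  by (simp add: compositions_def vsum_def)

lemma finite_vsum_eq: "finite {x :: 'd::finite \<Rightarrow> nat. vsum x = N}"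
  by (simp add: compositions_UNIV[symmetric] finite_compositions)

text \<open>The value \<open>m\<close> at the new index is split off. What remains is supported in
  \<open>I\<close>, hence 0 at \<open>i\<close>, so the updates \<open>k(i := m)\<close> and
  \<open>k(i := 0)\<close> undo each other.\<close>

lemma sum_compositions_insert:
  assumes "finite I" "i \<notin> I"
  shows "(\<Sum>k\<in>compositions (insert i I) N. f k) =
    (\<Sum>m\<le>N. \<Sum>k\<in>compositions I (N - m). f (k(i := m)))"
proof -
  have upd: "(\<Sum>j\<in>I. (k(i := m)) j) = (\<Sum>j\<in>I. k j)" for k :: "'a \<Rightarrow> nat" and m
    using assms by (intro sum.cong) auto
  have "(\<Sum>m\<le>N. \<Sum>k\<in>compositions I (N - m). f (k(i := m))) =
    (\<Sum>(m, k)\<in>Sigma {..N} (\<lambda>m. compositions I (N - m)). f (k(i := m)))"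
    by (rule sum.Sigma) (auto simp: finite_compositions assms)
  also have "\<dots> = (\<Sum>k\<in>compositions (insert i I) N. f k)"
    by (rule sum.reindex_bij_witness[of _ "\<lambda>k. (k i, k(i := 0))" "\<lambda>(m, k). k(i := m)"])
      (use assms upd in \<open>auto simp: compositions_def fun_eq_iff\<close>)
  finally show ?thesis ..
qed

text \<open>The homomorphism \<open>C\<close> embeds the real coefficients; it is the identity for real numbers and
  \<^const>\<open>const_poly\<close> for polynomials.\<close>

lemma multinomial_theorem_hom:
  fixes a :: "'i \<Rightarrow> 'a::comm_semiring_1" and C :: "real \<Rightarrow> 'a"
  assumes C_nat: "\<And>n. C (of_nat n) = of_nat n" and C_mult: "\<And>x y. C (x * y) = C x * C y"
    and "finite I"
  shows "(\<Sum>i\<in>I. a i) ^ N =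
    (\<Sum>k\<in>compositions I N. C (fact N / (\<Prod>i\<in>I. fact (k i))) * (\<Prod>i\<in>I. a i ^ k i))"
  using \<open>finite I\<close>
proof (induction I arbitrary: N)
  case empty
  have "compositions {} N = (if N = 0 then {\<lambda>_::'i. 0 :: nat} else {})"
    by (auto simp: compositions_def)
  then show ?case using C_nat[of 1] by (cases N) auto
next
  case (insert i I)
  \<comment> \<open>\<open>N choose m\<close> times \<open>fact (N - m)\<close> is
    \<open>fact N / fact m\<close>, and \<open>fact m\<close> is the denominator's factor at the new
    index.\<close>
  have coeff: "real (N choose m) * (fact (N - m) / (\<Prod>j\<in>I. fact (k j))) =
      fact N / (\<Prod>j\<in>insert i I. fact ((k(i := m)) j))" if "m \<le> N" for m k
  proof -
    have "(\<Prod>j\<in>I. fact ((k(i := m)) j)) = (\<Prod>j\<in>I. fact (k j) :: real)"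
      using insert by (intro prod.cong) auto
    then show ?thesis using insert that by (simp add: binomial_fact)
  qed
  have upd: "(\<Prod>j\<in>I. a j ^ (k(i := m)) j) = (\<Prod>j\<in>I. a j ^ k j)" for k m
    using insert by (intro prod.cong) auto
  have "(\<Sum>j\<in>insert i I. a j) ^ N = (a i + (\<Sum>j\<in>I. a j)) ^ N"
    using insert by simp
  also have "\<dots> = (\<Sum>m\<le>N. of_nat (N choose m) * a i ^ m * (\<Sum>j\<in>I. a j) ^ (N - m))"
    by (rule binomial_ring)
  also have "\<dots> = (\<Sum>m\<le>N. \<Sum>k\<in>compositions I (N - m).
      C (real (N choose m) * (fact (N - m) / (\<Prod>j\<in>I. fact (k j)))) *
        (a i ^ m * (\<Prod>j\<in>I. a j ^ k j)))"
    unfolding insert.IH sum_distrib_left C_mult C_nat by (simp add: mult_ac)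
  also have "\<dots> = (\<Sum>m\<le>N. \<Sum>k\<in>compositions I (N - m).
      C (fact N / (\<Prod>j\<in>insert i I. fact ((k(i := m)) j))) *
        (\<Prod>j\<in>insert i I. a j ^ (k(i := m)) j))"
  proof (intro sum.cong refl)
    fix m k assume "m \<in> {..N}"
    then have "m \<le> N" by simp
    moreover have "(\<Prod>j\<in>insert i I. a j ^ (k(i := m)) j) = a i ^ m * (\<Prod>j\<in>I. a j ^ k j)"
      using insert.hyps upd by simp
    ultimately show "C (real (N choose m) * (fact (N - m) / (\<Prod>j\<in>I. fact (k j)))) *
        (a i ^ m * (\<Prod>j\<in>I. a j ^ k j)) =
      C (fact N / (\<Prod>j\<in>insert i I. fact ((k(i := m)) j))) *
        (\<Prod>j\<in>insert i I. a j ^ (k(i := m)) j)"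
      by (simp only: coeff)
  qed
  also have "\<dots> = (\<Sum>k\<in>compositions (insert i I) N.
      C (fact N / (\<Prod>i\<in>insert i I. fact (k i))) * (\<Prod>i\<in>insert i I. a i ^ k i))"
    using insert.hyps by (rule sum_compositions_insert[symmetric])
  finally show ?case .
qed

lemma multinomial_theorem:
  fixes a :: "'i \<Rightarrow> real"
  assumes "finite I"
  shows "(\<Sum>i\<in>I. a i) ^ N =
    (\<Sum>k\<in>compositions I N. fact N / (\<Prod>i\<in>I. fact (k i)) * (\<Prod>i\<in>I. a i ^ k i))"
  using multinomial_theorem_hom[of "\<lambda>x. x" I a N] assms by simp

section \<open>Monomials in several variables and their linear independence\<close>

definition vpow :: "('d::finite \<Rightarrow> 'a::comm_monoid_mult) \<Rightarrow> ('d \<Rightarrow> nat) \<Rightarrow> 'a" where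
  "vpow s x = (\<Prod>j\<in>UNIV. s j ^ x j)"

lemma vpow_mult: "vpow (\<lambda>j. s j * t j) x = vpow s x * vpow t x"
  by (simp add: vpow_def power_mult_distrib prod.distrib)

lemma vpow_diff: "z \<le> x \<Longrightarrow> vpow s x = vpow s z * vpow s (x - z)"
  by (simp add: vpow_def prod.distrib[symmetric] power_add[symmetric] le_fun_def)

lemma vpow_pos: "(\<And>j. p j > (0::real)) \<Longrightarrow> vpow p x > 0"
  by (simp add: vpow_def prod_pos)

lemma vsum_mono: "z \<le> x \<Longrightarrow> vsum z \<le> vsum x"
  by (simp add: vsum_def le_fun_def sum_mono)

lemma vsum_diff: "z \<le> x \<Longrightarrow> vsum (x - z) = vsum x - vsum z"
  by (simp add: vsum_def le_fun_def sum_subtractf_nat)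

lemma power_sum_eq_multinom:
  fixes a :: "'d::finite \<Rightarrow> real"
  shows "(\<Sum>j\<in>UNIV. a j) ^ N = (\<Sum>x\<in>compositions UNIV N. multinom N x * vpow a x)"
  using multinomial_theorem[of UNIV a N] by (simp add: multinom_def vpow_def)

text \<open>Induction on the variables: sorting \<open>A\<close> by the exponent of one variable
  \<open>v\<close> gives a polynomial in \<open>s v\<close> that vanishes at every real number. Its
  coefficients, which are sums of monomials in fewer variables, therefore vanish. That
  \<open>V\<close> separates \<open>A\<close> keeps distinct exponent vectors from giving the same
  monomial; once no variable is left it makes \<open>A\<close> a singleton.\<close>

lemma sum_monomials_eq_0_imp:
  fixes c :: "('d \<Rightarrow> nat) \<Rightarrow> real"
  assumes "finite V" "finite A" "\<And>x y. x \<in> A \<Longrightarrow> y \<in> A \<Longrightarrow> (\<And>j. j \<in> V \<Longrightarrow> x j = y j) \<Longrightarrow> x = y"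
    and "\<And>s. (\<Sum>x\<in>A. c x * (\<Prod>j\<in>V. s j ^ x j)) = 0" "x \<in> A"
  shows "c x = 0"
  using assms
proof (induction V arbitrary: A)
  case empty
  then have "A = {x}" by auto
  then show ?case using empty by simp
next
  case (insert v V)
  \<comment> \<open>\<open>g s k\<close> is the coefficient of the \<open>k\<close>-th power of the
    variable \<open>v\<close>, and \<open>n\<close> bounds the degree.\<close>
  define g where "g s k = (\<Sum>y | y \<in> A \<and> y v = k. c y * (\<Prod>j\<in>V. s j ^ y j))" for s k
  define n where "n = Max ((\<lambda>y. y v) ` A)"
  have n: "y v \<le> n" if "y \<in> A" for y
    unfolding n_def using that insert.prems(1) by simp
  have "\<forall>r. (\<Sum>k\<le>n. g s k * r ^ k) = 0" for s
  proof
    fix r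
    have upd: "(\<Prod>j\<in>V. (s(v := r)) j ^ y j) = (\<Prod>j\<in>V. s j ^ y j)" for y
      using insert.hyps by (intro prod.cong) auto
    have "(\<Sum>k\<le>n. g s k * r ^ k) =
        (\<Sum>k\<le>n. \<Sum>y | y \<in> A \<and> y v = k. c y * (\<Prod>j\<in>insert v V. (s(v := r)) j ^ y j))"
      unfolding g_def sum_distrib_right
      using insert.hyps upd by (intro sum.cong) (auto simp: mult_ac)
    also have "\<dots> = (\<Sum>y\<in>A. c y * (\<Prod>j\<in>insert v V. (s(v := r)) j ^ y j))"
      using insert.prems(1) n by (intro sum.group) auto
    finally show "(\<Sum>k\<le>n. g s k * r ^ k) = 0" using insert.prems(3) by simp
  qed
  then have "\<forall>k\<le>n. g s k = 0" for s
    by (subst (asm) polyfun_eq_0) blast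
  then have g0: "g s (x v) = 0" for s using n insert.prems(4) by blast
  show ?case
  proof (rule insert.IH[of "{y. y \<in> A \<and> y v = x v}"])
    show "a = b" if "a \<in> {y. y \<in> A \<and> y v = x v}" "b \<in> {y. y \<in> A \<and> y v = x v}"
      "\<And>j. j \<in> V \<Longrightarrow> a j = b j" for a b
      using that by (intro insert.prems(2)) auto
    show "(\<Sum>y | y \<in> A \<and> y v = x v. c y * (\<Prod>j\<in>V. s j ^ y j)) = 0" for s
      using g0[of s] by (simp add: g_def)
  qed (use insert.prems in auto)
qed

text \<open>Linear independence of monomials is used twice. With \<open>t\<close> fixed, the
  coefficients \<open>h t x\<close> of the monomials in \<open>s\<close> vanish; each of them is a
  combination of monomials in \<open>t\<close>, so its coefficients vanish too.\<close>

lemma bivariate_coeffs_eqI: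
  fixes f g :: "('d::finite \<Rightarrow> nat) \<Rightarrow> ('d \<Rightarrow> nat) \<Rightarrow> real"
  assumes "finite A"
    and eq: "\<And>s t. (\<Sum>x\<in>A. \<Sum>y\<in>A. f x y * vpow s x * vpow t y) =
      (\<Sum>x\<in>A. \<Sum>y\<in>A. g x y * vpow s x * vpow t y)"
    and "x \<in> A" "y \<in> A"
  shows "f x y = g x y"
proof -
  define h where "h t x = (\<Sum>y\<in>A. (f x y - g x y) * vpow t y)" for t x
  have "(\<Sum>x\<in>A. h t x * (\<Prod>j\<in>UNIV. s j ^ x j)) = 0" for s t
  proof -
    have "(\<Sum>x\<in>A. h t x * vpow s x) = (\<Sum>x\<in>A. \<Sum>y\<in>A. f x y * vpow s x * vpow t y) -
      (\<Sum>x\<in>A. \<Sum>y\<in>A. g x y * vpow s x * vpow t y)"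
      unfolding h_def sum_distrib_right sum_subtractf[symmetric] by (simp add: algebra_simps)
    then show ?thesis using eq by (simp add: vpow_def)
  qed
  then have h0: "h t x = 0" for t
    using sum_monomials_eq_0_imp[of UNIV A "h t" x] assms by auto
  have "f x y - g x y = 0"
    by (rule sum_monomials_eq_0_imp[of UNIV A "\<lambda>y. f x y - g x y" y])
      (use h0 assms in \<open>auto simp: h_def vpow_def\<close>)
  then show ?thesis by simp
qed

text \<open>Weighted by the square roots of \<open>p\<close>, the functions \<open>u l\<close> are
  the orthonormal rows of a square matrix. A right inverse of a square matrix is also a left
  inverse, so the columns are orthonormal as well; dividing by the weights gives the
  identity.\<close>

lemma orthonormal_system_complete:
  fixes u :: "nat \<Rightarrow> 'd::finite \<Rightarrow> real"
  assumes "orthonormal_system p u" "\<And>j. p j > 0"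
  shows "(\<Sum>l<CARD('d). u l i * u l j) = (if i = j then 1 / p i else 0)"
proof -
  obtain e :: "'d \<Rightarrow> nat" where e: "bij_betw e UNIV {0..<CARD('d)}"
    using ex_bij_betw_finite_nat[OF finite[of "UNIV :: 'd set"]] by blast
  have e_less: "e i < CARD('d)" for i using bij_betwE[OF e] by simp
  have e_inj: "e i = e j \<longleftrightarrow> i = j" for i j
    using e by (auto simp: bij_betw_def inj_on_def)
  \<comment> \<open>Rows and columns share one index type, so the bijection \<open>e\<close>
    relabels the functions \<open>u l\<close> by elements of \<open>'d\<close>.\<close>
  define A :: "real^'d^'d" where "A = (\<chi> i j. u (e i) j * sqrt (p j))"
  have sq: "sqrt (p j) * sqrt (p j) = p j" for j
    using assms(2)[of j] by simp
  have "A ** transpose A = mat 1"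
  proof -
    have "(\<Sum>k\<in>UNIV. u (e i) k * sqrt (p k) * (u (e j) k * sqrt (p k))) =
        (if i = j then 1 else 0)" for i j
    proof -
      have "(\<Sum>k\<in>UNIV. u (e i) k * sqrt (p k) * (u (e j) k * sqrt (p k))) =
          (\<Sum>k\<in>UNIV. u (e i) k * u (e j) k * p k)"
      proof (rule sum.cong[OF refl])
        fix k
        have "u (e i) k * sqrt (p k) * (u (e j) k * sqrt (p k)) =
          u (e i) k * u (e j) k * (sqrt (p k) * sqrt (p k))" by (simp add: mult_ac)
        then show "u (e i) k * sqrt (p k) * (u (e j) k * sqrt (p k)) = u (e i) k * u (e j) k * p k"
          unfolding sq .
      qed
      then show ?thesis
        using assms(1) e_less e_inj by (simp add: orthonormal_system_def)
    qed
    then show ?thesis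
      by (simp add: vec_eq_iff A_def matrix_matrix_mult_def transpose_def mat_def)
  qed
  then have "transpose A ** A = mat 1"
    by (simp add: matrix_left_right_inverse)
  then have "(\<Sum>k\<in>UNIV. u (e k) i * sqrt (p i) * (u (e k) j * sqrt (p j))) =
      (if i = j then 1 else 0)"
    by (simp add: vec_eq_iff A_def matrix_matrix_mult_def transpose_def mat_def)
  moreover have "(\<Sum>k\<in>UNIV. u (e k) i * sqrt (p i) * (u (e k) j * sqrt (p j))) =
      (\<Sum>l<CARD('d). u l i * u l j) * (sqrt (p i) * sqrt (p j))"
    using sum.reindex_bij_betw[OF e, of "\<lambda>l. u l i * sqrt (p i) * (u l j * sqrt (p j))"]
    by (simp add: sum_distrib_left sum_distrib_right mult_ac atLeast0LessThan)
  ultimately have "(\<Sum>l<CARD('d). u l i * u l j) * (sqrt (p i) * sqrt (p j)) =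
      (if i = j then 1 else 0)" by simp
  moreover have "sqrt (p i) > 0" "sqrt (p j) > 0" using assms(2) by auto
  ultimately show ?thesis
    using sq[of i] assms(2)[of i]
    by (cases "i = j") (auto simp: nonzero_eq_divide_eq less_imp_neq)
qed

text \<open>The inner sums on the left are the Fourier coefficients of \<open>s\<close> and
  \<open>t\<close> with respect to \<open>u\<close>. Completeness collapses the double sum over
  \<open>i\<close> and \<open>j\<close> to its diagonal, where \<open>1 / p i\<close> cancels one of
  two weights.\<close>

lemma orthonormal_system_parseval:
  fixes u :: "nat \<Rightarrow> 'd::finite \<Rightarrow> real"
  assumes "orthonormal_system p u" "\<And>j. p j > 0"
  shows "(\<Sum>l<CARD('d). (\<Sum>j\<in>UNIV. s j * p j * u l j) * (\<Sum>j\<in>UNIV. t j * p j * u l j)) =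
    (\<Sum>j\<in>UNIV. p j * s j * t j)"
proof -
  have "(\<Sum>l<CARD('d). (\<Sum>j\<in>UNIV. s j * p j * u l j) * (\<Sum>j\<in>UNIV. t j * p j * u l j)) =
      (\<Sum>l<CARD('d). \<Sum>i\<in>UNIV. \<Sum>j\<in>UNIV. s i * p i * (t j * p j) * (u l i * u l j))"
    by (simp add: sum_product mult_ac)
  also have "\<dots> = (\<Sum>i\<in>UNIV. \<Sum>j\<in>UNIV. \<Sum>l<CARD('d). s i * p i * (t j * p j) * (u l i * u l j))"
    by (rule sum_swap_outer[symmetric])
  also have "\<dots> = (\<Sum>i\<in>UNIV. \<Sum>j\<in>UNIV. s i * p i * (t j * p j) * (if i = j then 1 / p i else 0))"
    by (simp add: sum_distrib_left[symmetric] orthonormal_system_complete[OF assms])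
  also have "\<dots> = (\<Sum>i\<in>UNIV. p i * s i * t i)"
  proof (rule sum.cong[OF refl])
    fix i
    have "(\<Sum>j\<in>UNIV. s i * p i * (t j * p j) * (if i = j then 1 / p i else 0)) =
        s i * p i * (t i * p i) * (1 / p i)"
      by (simp add: if_distrib[of "\<lambda>x. _ * x"] cong: if_cong)
    also have "\<dots> = p i * s i * t i" using assms(2)[of i] by simp
    finally show "(\<Sum>j\<in>UNIV. s i * p i * (t j * p j) * (if i = j then 1 / p i else 0)) =
        p i * s i * t i" .
  qed
  finally show ?thesis .
qed

section \<open>Generating functions of Krawtchouk polynomials and kernels\<close>

lemma const_poly_of_nat: "const_poly (of_nat n) = of_nat n"
  by (simp add: const_poly_def)

lemma const_poly_mult: "const_poly (x * y) = const_poly x * const_poly y"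
  by (simp add: const_poly_def mult_single)

lemma const_poly_1: "const_poly 1 = 1"
  by (simp add: const_poly_def)

lemma const_poly_sum: "const_poly (\<Sum>i\<in>I. f i) = (\<Sum>i\<in>I. const_poly (f i))"
  by (induction I rule: infinite_finite_induct) (auto simp: const_poly_def single_add)

lemma const_poly_power: "const_poly (x ^ n) = const_poly x ^ n"
  by (induction n) (auto simp: const_poly_1 const_poly_mult)

lemma const_poly_prod: "const_poly (\<Prod>i\<in>I. f i) = (\<Prod>i\<in>I. const_poly (f i))"
  by (induction I rule: infinite_finite_induct) (auto simp: const_poly_1 const_poly_mult)

lemma lookup_const_poly_mult:
  "Poly_Mapping.lookup (const_poly c * q) n = c * Poly_Mapping.lookup q n"
  by (simp add: const_poly_def mult_map_scale_conv_mult[symmetric] Poly_Mapping.map.rep_eq when_def)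

text \<open>The inverse of \<open>Poly_Mapping.lookup\<close> on exponent vectors supported in a
  finite set \<open>I\<close>.\<close>

definition multiindex_of :: "nat set \<Rightarrow> (nat \<Rightarrow> nat) \<Rightarrow> multiindex" where
  "multiindex_of I k = (\<Sum>l\<in>I. Poly_Mapping.single l (k l))"

lemma lookup_multiindex_of:
  "finite I \<Longrightarrow> Poly_Mapping.lookup (multiindex_of I k) i = (if i \<in> I then k i else 0)"
  by (simp add: multiindex_of_def lookup_sum lookup_single when_def)

lemma wvar_power: "wvar l ^ k = Poly_Mapping.single (Poly_Mapping.single l k) 1"
proof (induction k)
  case (Suc k)
  have "wvar l * wvar l ^ k = Poly_Mapping.single (Poly_Mapping.single l 1 + Poly_Mapping.single l k) 1"
    by (simp only: Suc) (simp add: wvar_def mult_single)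
  then show ?case by (simp add: single_add[symmetric])
qed simp

lemma prod_wvar_power:
  "(\<Prod>l\<in>I. wvar l ^ k l) = Poly_Mapping.single (multiindex_of I k) 1"
  by (induction I rule: infinite_finite_induct)
    (auto simp: multiindex_of_def wvar_power mult_single)

lemma lookup_multiindices_in:
  assumes "n \<in> multiindices r m"
  shows "Poly_Mapping.lookup n \<in> compositions {1..<r} m"
proof -
  have "Poly_Mapping.lookup n i = 0" if "i \<notin> {1..<r}" for i
    using assms that by (force simp: multiindices_def in_keys_iff)
  then show ?thesis using assms by (simp add: multiindices_def compositions_def)
qed

lemma multiindex_of_in:
  assumes "k \<in> compositions {1..<r} m"
  shows "multiindex_of {1..<r} k \<in> multiindices r m"
  using assms unfolding multiindices_def compositions_def
  by (auto simp: lookup_multiindex_of in_keys_iff split: if_splits)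

text \<open>Passes from finitely supported exponent vectors to \<open>compositions\<close>, the
  index set of the multinomial theorem.\<close>

lemma sum_multiindices:
  "(\<Sum>n\<in>multiindices r m. f (Poly_Mapping.lookup n)) = (\<Sum>k\<in>compositions {1..<r} m. f k)"
proof (rule sum.reindex_bij_witness[of _ "multiindex_of {1..<r}" Poly_Mapping.lookup])
  fix n assume "n \<in> multiindices r m"
  from lookup_multiindices_in[OF this]
  show "multiindex_of {1..<r} (Poly_Mapping.lookup n) = n"
    by (intro poly_mapping_eqI) (auto simp: lookup_multiindex_of compositions_def)
next
  fix k assume "k \<in> compositions {1..<r} m"
  then show "Poly_Mapping.lookup (multiindex_of {1..<r} k) = k"
    by (auto simp: lookup_multiindex_of compositions_def fun_eq_iff)
qed (auto simp: lookup_multiindices_in multiindex_of_in simp del: One_nat_def)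

text \<open>The constant term is treated as a further summand, of index 0 and with the trivial
  variable 1. In the multinomial expansion the monomial with exponents \<open>n\<close> then comes
  from exactly one composition of \<open>N\<close>, whose part at 0 is forced to be
  \<open>N - m\<close>. Its multinomial coefficient is
  \<open>krawtchouk_norm2 r N n\<close>.\<close>

lemma coeff_linear_form_power:
  assumes "n \<in> multiindices r m" "m \<le> N" "r > 0"
  shows "Poly_Mapping.lookup ((const_poly (T 0) + (\<Sum>l\<in>{1..<r}. wvar l * const_poly (T l))) ^ N) n =
    krawtchouk_norm2 r N n * T 0 ^ (N - m) * (\<Prod>l\<in>{1..<r}. T l ^ Poly_Mapping.lookup n l)"
proof -
  define W where "W l = (if l = 0 then 1 else wvar l)" for l
  define e where "e k = multiindex_of {1..<r} k" for k
  define c where "c k = fact N / (\<Prod>l<r. fact (k l)) * (\<Prod>l<r. T l ^ k l)" for k :: "nat \<Rightarrow> nat"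
  have lessThan: "{..<r} = insert 0 {1..<r}" using assms by auto
  have "(const_poly (T 0) + (\<Sum>l\<in>{1..<r}. wvar l * const_poly (T l))) ^ N =
      (\<Sum>l<r. const_poly (T l) * W l) ^ N"
    unfolding lessThan by (simp add: W_def mult.commute)
  also have "\<dots> = (\<Sum>k\<in>compositions {..<r} N. const_poly (fact N / (\<Prod>l<r. fact (k l))) *
      (\<Prod>l<r. (const_poly (T l) * W l) ^ k l))"
    by (rule multinomial_theorem_hom) (auto simp: const_poly_of_nat const_poly_mult)
  also have "\<dots> = (\<Sum>k\<in>compositions {..<r} N. const_poly (c k) * Poly_Mapping.single (e k) 1)"
  proof (rule sum.cong[OF refl])
    fix k
    have "(\<Prod>l<r. W l ^ k l) = Poly_Mapping.single (e k) 1"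
      unfolding lessThan e_def by (simp add: W_def prod_wvar_power[symmetric])
    then show "const_poly (fact N / (\<Prod>l<r. fact (k l))) *
        (\<Prod>l<r. (const_poly (T l) * W l) ^ k l) = const_poly (c k) * Poly_Mapping.single (e k) 1"
      by (simp only: c_def const_poly_mult const_poly_prod const_poly_power power_mult_distrib
          prod.distrib mult.assoc)
  qed
  finally have "Poly_Mapping.lookup
      ((const_poly (T 0) + (\<Sum>l\<in>{1..<r}. wvar l * const_poly (T l))) ^ N) n =
      (\<Sum>k\<in>compositions {..<r} N. if e k = n then c k else 0)"
    by (simp add: lookup_sum lookup_const_poly_mult lookup_single when_def
        if_distrib[of "\<lambda>x. _ * x"] cong: if_cong)
  \<comment> \<open>\<open>e k\<close> forgets the part at 0, which the total \<open>N\<close>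
    restores, so \<open>e k = n\<close> has a single solution.\<close>
  also have "\<dots> = (\<Sum>k\<in>{(Poly_Mapping.lookup n)(0 := N - m)}. if e k = n then c k else 0)"
  proof (rule sum.mono_neutral_right)
    have n: "\<And>i. i \<notin> {1..<r} \<Longrightarrow> Poly_Mapping.lookup n i = 0"
      "(\<Sum>l\<in>{1..<r}. Poly_Mapping.lookup n l) = m"
      using lookup_multiindices_in[OF assms(1)] by (auto simp: compositions_def)
    show "{(Poly_Mapping.lookup n)(0 := N - m)} \<subseteq> compositions {..<r} N"
      using n assms by (auto simp: compositions_def lessThan)
    show "\<forall>k\<in>compositions {..<r} N - {(Poly_Mapping.lookup n)(0 := N - m)}.
        (if e k = n then c k else 0) = 0"
    proof
      fix k assume k: "k \<in> compositions {..<r} N - {(Poly_Mapping.lookup n)(0 := N - m)}"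
      have "k = (Poly_Mapping.lookup n)(0 := N - m)" if "e k = n"
      proof
        fix i
        have eq: "Poly_Mapping.lookup n l = k l" if "l \<in> {1..<r}" for l
          using that \<open>e k = n\<close> by (auto simp: e_def lookup_multiindex_of)
        have "(\<Sum>l\<in>{1..<r}. k l) = m"
          using n(2) eq by simp
        then have "k 0 + m = N"
          using k by (simp add: compositions_def lessThan)
        moreover have "k i = 0" if "i \<notin> {..<r}"
          using k that by (simp add: compositions_def)
        ultimately show "k i = ((Poly_Mapping.lookup n)(0 := N - m)) i"
          using eq[of i] n(1)[of i] by (cases "i = 0"; cases "i < r") auto
      qed
      then show "(if e k = n then c k else 0) = 0" using k by auto
    qed
  qed (simp add: finite_compositions)
  also have "\<dots> = c ((Poly_Mapping.lookup n)(0 := N - m))"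
  proof -
    have "e ((Poly_Mapping.lookup n)(0 := N - m)) = n"
      using lookup_multiindices_in[OF assms(1)]
      by (intro poly_mapping_eqI) (auto simp: e_def lookup_multiindex_of compositions_def)
    then show ?thesis by simp
  qed
  also have "\<dots> = krawtchouk_norm2 r N n * T 0 ^ (N - m) *
      (\<Prod>l\<in>{1..<r}. T l ^ Poly_Mapping.lookup n l)"
    using assms(1) by (simp add: c_def lessThan krawtchouk_norm2_def multiindices_def mult_ac)
  finally show ?thesis .
qed

text \<open>Weighting the linear factor of index \<open>j\<close> by \<open>s j * p j\<close> and
  summing over \<open>j\<close> gives one linear form with coefficients \<open>T l\<close>. The
  multinomial theorem writes its \<open>N\<close>-th power as a weighted sum of the polynomials
  \<open>krawtchouk_gen u x\<close>, and the coefficients at \<open>n\<close> are compared.\<close>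

lemma sum_multinomial_krawtchouk:
  fixes u :: "nat \<Rightarrow> 'd::finite \<Rightarrow> real"
  assumes u0: "\<And>j. u 0 j = 1" and n: "n \<in> multiindices CARD('d) m" "m \<le> N"
  shows "(\<Sum>x\<in>compositions UNIV N. multinomial_prob N p x * (vpow s x * krawtchouk u n x)) =
    krawtchouk_norm2 CARD('d) N n * (\<Sum>j\<in>UNIV. s j * p j) ^ (N - m) *
    (\<Prod>l\<in>{1..<CARD('d)}. (\<Sum>j\<in>UNIV. s j * p j * u l j) ^ Poly_Mapping.lookup n l)"
proof -
  define T where "T l = (\<Sum>j\<in>UNIV. s j * p j * u l j)" for l
  define L where "L j = 1 + (\<Sum>l\<in>{1..<CARD('d)}. wvar l * const_poly (u l j))" for j
  have T0: "T 0 = (\<Sum>j\<in>UNIV. s j * p j)" by (simp add: T_def u0)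
  have "(\<Sum>j\<in>UNIV. const_poly (s j * p j) * L j) =
      const_poly (T 0) + (\<Sum>l\<in>{1..<CARD('d)}. wvar l * const_poly (T l))"
    unfolding L_def T0 T_def
    by (simp add: const_poly_sum const_poly_mult const_poly_1 u0 distrib_left sum.distrib sum_distrib_left mult_ac)
      (rule sum.swap)
  then have "(const_poly (T 0) + (\<Sum>l\<in>{1..<CARD('d)}. wvar l * const_poly (T l))) ^ N =
      (\<Sum>x\<in>compositions UNIV N. const_poly (fact N / (\<Prod>j\<in>UNIV. fact (x j))) *
        (\<Prod>j\<in>UNIV. (const_poly (s j * p j) * L j) ^ x j))"
    using multinomial_theorem_hom[of const_poly UNIV "\<lambda>j. const_poly (s j * p j) * L j" N]
    by (simp add: const_poly_of_nat const_poly_mult)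
  also have "\<dots> = (\<Sum>x\<in>compositions UNIV N.
      const_poly (multinomial_prob N p x * vpow s x) * krawtchouk_gen u x)"
    by (intro sum.cong refl)
      (simp only: multinomial_prob_def multinom_def vpow_def krawtchouk_gen_def L_def
        power_mult_distrib prod.distrib const_poly_mult const_poly_prod const_poly_power mult_ac)
  finally have "Poly_Mapping.lookup
      ((const_poly (T 0) + (\<Sum>l\<in>{1..<CARD('d)}. wvar l * const_poly (T l))) ^ N) n =
      (\<Sum>x\<in>compositions UNIV N. multinomial_prob N p x * (vpow s x * krawtchouk u n x))"
    by (simp add: lookup_sum lookup_const_poly_mult krawtchouk_def mult.assoc)
  then show ?thesis
    using coeff_linear_form_power[OF n, of T] by (simp add: T0) (simp add: T_def)
qed

section \<open>Generating function of the kernel polynomials\<close>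

lemma krawtchouk_norm2_pos: "krawtchouk_norm2 r N n > 0"
  by (simp add: krawtchouk_norm2_def prod_pos)

lemma kernel_poly_eq:
  fixes u :: "nat \<Rightarrow> 'd::finite \<Rightarrow> real"
  shows "kernel_poly N u n x y = (\<Sum>k\<in>multiindices CARD('d) n.
    krawtchouk u k x * krawtchouk u k y / krawtchouk_norm2 CARD('d) N k)"
  unfolding kernel_poly_def krawtchouk_normalized_def
  using krawtchouk_norm2_pos by (intro sum.cong refl) (simp add: less_imp_le)

text \<open>Both transforms contain the norm, so one factor survives the division; it splits into
  \<open>N choose n\<close> and a multinomial coefficient of \<open>n\<close>. The sum over
  multi-indices is then the multinomial theorem for the products \<open>v l\<close> with
  \<open>l\<close> at least 1, whose total comes from Parseval's identity.\<close>

lemma sum_multinomial_kernel: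
  fixes u :: "nat \<Rightarrow> 'd::finite \<Rightarrow> real"
  assumes u: "orthonormal_system p u" and p: "\<And>j. p j > 0" and n: "n \<le> N"
  shows "(\<Sum>k\<in>multiindices CARD('d) n.
      (\<Sum>x\<in>compositions UNIV N. multinomial_prob N p x * (vpow s x * krawtchouk u k x)) *
      (\<Sum>y\<in>compositions UNIV N. multinomial_prob N p y * (vpow t y * krawtchouk u k y)) /
      krawtchouk_norm2 CARD('d) N k) =
    real (N choose n) * ((\<Sum>j\<in>UNIV. s j * p j) * (\<Sum>j\<in>UNIV. t j * p j)) ^ (N - n) *
    ((\<Sum>j\<in>UNIV. p j * s j * t j) - (\<Sum>j\<in>UNIV. s j * p j) * (\<Sum>j\<in>UNIV. t j * p j)) ^ n"
    (is "?lhs = real (N choose n) * (?S * ?T) ^ (N - n) * (?P - ?S * ?T) ^ n")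
proof -
  let ?I = "{1..<CARD('d)}"
  have u0: "u 0 j = 1" for j using u by (simp add: orthonormal_system_def)
  define v where "v l = (\<Sum>j\<in>UNIV. s j * p j * u l j) * (\<Sum>j\<in>UNIV. t j * p j * u l j)" for l
  \<comment> \<open>Since \<open>u 0\<close> is constantly 1, the term to be removed from Parseval's
    identity is \<open>?S * ?T\<close>.\<close>
  have "(\<Sum>l<CARD('d). v l) = v 0 + (\<Sum>l\<in>?I. v l)"
    by (simp add: lessThan_atLeast0 sum.atLeast_Suc_lessThan)
  then have v: "(\<Sum>l\<in>?I. v l) = ?P - ?S * ?T"
    using orthonormal_system_parseval[OF u p, of s t] by (simp add: v_def u0)
  have "?lhs = (\<Sum>k\<in>multiindices CARD('d) n. real (N choose n) * (?S * ?T) ^ (N - n) *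
      (fact n / (\<Prod>l\<in>?I. fact (Poly_Mapping.lookup k l)) * (\<Prod>l\<in>?I. v l ^ Poly_Mapping.lookup k l)))"
  proof (rule sum.cong[OF refl])
    fix k assume k: "k \<in> multiindices CARD('d) n"
    have "krawtchouk_norm2 CARD('d) N k =
        real (N choose n) * (fact n / (\<Prod>l\<in>?I. fact (Poly_Mapping.lookup k l)))"
      using k n by (simp add: krawtchouk_norm2_def multiindices_def binomial_fact)
    moreover have "a * b * c * (a * b' * c') / a = a * (b * b') * (c * c')" for a b c b' c' :: real
      by simp
    ultimately show "(\<Sum>x\<in>compositions UNIV N. multinomial_prob N p x * (vpow s x * krawtchouk u k x)) *
      (\<Sum>y\<in>compositions UNIV N. multinomial_prob N p y * (vpow t y * krawtchouk u k y)) /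
      krawtchouk_norm2 CARD('d) N k = real (N choose n) * (?S * ?T) ^ (N - n) *
      (fact n / (\<Prod>l\<in>?I. fact (Poly_Mapping.lookup k l)) * (\<Prod>l\<in>?I. v l ^ Poly_Mapping.lookup k l))"
      unfolding sum_multinomial_krawtchouk[where u = u, OF u0 k n]
      by (simp add: v_def power_mult_distrib prod.distrib mult_ac)
  qed
  also have "\<dots> = real (N choose n) * (?S * ?T) ^ (N - n) * (\<Sum>l\<in>?I. v l) ^ n"
    unfolding sum_distrib_left[symmetric]
      sum_multiindices[where f = "\<lambda>k. fact n / (\<Prod>l\<in>?I. fact (k l)) * (\<Prod>l\<in>?I. v l ^ k l)"]
    by (subst multinomial_theorem) auto
  finally show ?thesis unfolding v .
qed

text \<open>For each multi-index the summand is a function of \<open>x\<close> times a function of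
  \<open>y\<close>, so the double sum factorises.\<close>

lemma kernel_poly_gf:
  fixes u :: "nat \<Rightarrow> 'd::finite \<Rightarrow> real"
  assumes u: "orthonormal_system p u" and p: "\<And>j. p j > 0" and n: "n \<le> N"
  shows "(\<Sum>x\<in>compositions UNIV N. \<Sum>y\<in>compositions UNIV N.
      multinomial_prob N p x * multinomial_prob N p y * kernel_poly N u n x y * vpow s x * vpow t y) =
    real (N choose n) * ((\<Sum>j\<in>UNIV. s j * p j) * (\<Sum>j\<in>UNIV. t j * p j)) ^ (N - n) *
    ((\<Sum>j\<in>UNIV. p j * s j * t j) - (\<Sum>j\<in>UNIV. s j * p j) * (\<Sum>j\<in>UNIV. t j * p j)) ^ n"
proof -
  have "(\<Sum>x\<in>compositions UNIV N. \<Sum>y\<in>compositions UNIV N.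
      multinomial_prob N p x * multinomial_prob N p y * kernel_poly N u n x y * vpow s x * vpow t y) =
    (\<Sum>x\<in>compositions UNIV N. \<Sum>y\<in>compositions UNIV N. \<Sum>k\<in>multiindices CARD('d) n.
      multinomial_prob N p x * (vpow s x * krawtchouk u k x) *
      (multinomial_prob N p y * (vpow t y * krawtchouk u k y)) / krawtchouk_norm2 CARD('d) N k)"
    by (simp add: kernel_poly_eq sum_distrib_left sum_distrib_right mult_ac)
  also have "\<dots> = (\<Sum>k\<in>multiindices CARD('d) n.
      (\<Sum>x\<in>compositions UNIV N. multinomial_prob N p x * (vpow s x * krawtchouk u k x)) *
      (\<Sum>y\<in>compositions UNIV N. multinomial_prob N p y * (vpow t y * krawtchouk u k y)) /
      krawtchouk_norm2 CARD('d) N k)"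
    by (subst sum_swap_outer) (simp add: sum_product sum_divide_distrib)
  finally show ?thesis unfolding sum_multinomial_kernel[OF u p n] .
qed

section \<open>Kernels as mixtures over common parts\<close>

text \<open>The bivariate kernel with generating function
  \<open>(\<Sum>j. p j * s j * t j) ^ k * ((\<Sum>j. s j * p j) * (\<Sum>j. t j * p j)) ^ (N - k)\<close>.\<close>

definition overlap_kernel ::
  "nat \<Rightarrow> ('d::finite \<Rightarrow> real) \<Rightarrow> nat \<Rightarrow> ('d \<Rightarrow> nat) \<Rightarrow> ('d \<Rightarrow> nat) \<Rightarrow> real" where
  "overlap_kernel N p k x y = (\<Sum>z | z \<le> x \<and> z \<le> y \<and> vsum z = k.
     multinom k z * vpow p z * (multinom (N - k) (x - z) * vpow p (x - z)) *
     (multinom (N - k) (y - z) * vpow p (y - z)))"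

text \<open>Substituting \<open>x = z + w\<close>, with \<open>w\<close> running over all vectors of
  size \<open>N - k\<close>, leaves a full multinomial expansion times the monomial of
  \<open>z\<close>.\<close>

lemma sum_shifted_multinomial:
  fixes s p :: "'d::finite \<Rightarrow> real"
  assumes "vsum z = k" "k \<le> N"
  shows "(\<Sum>x | x \<in> compositions UNIV N \<and> z \<le> x.
      multinom (N - k) (x - z) * vpow p (x - z) * vpow s x) =
    vpow s z * (\<Sum>j\<in>UNIV. s j * p j) ^ (N - k)"
proof -
  have "(\<Sum>x | x \<in> compositions UNIV N \<and> z \<le> x.
      multinom (N - k) (x - z) * vpow p (x - z) * vpow s x) =
    (\<Sum>w\<in>compositions UNIV (N - k). vpow s z * (multinom (N - k) w * vpow (\<lambda>j. s j * p j) w))"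
  proof (rule sum.reindex_bij_witness[of _ "\<lambda>w j. z j + w j" "\<lambda>x. x - z"])
    show "(\<lambda>j. z j + w j) \<in> {x. x \<in> compositions UNIV N \<and> z \<le> x}" if "w \<in> compositions UNIV (N - k)" for w
      using that assms by (auto simp: compositions_UNIV vsum_def le_fun_def sum.distrib)
    fix x assume "x \<in> {x. x \<in> compositions UNIV N \<and> z \<le> x}"
    then have x: "vsum x = N" "z \<le> x" by (auto simp: compositions_UNIV)
    show "(\<lambda>j. z j + (x - z) j) = x" using x(2) by (auto simp: le_fun_def)
    show "x - z \<in> compositions UNIV (N - k)" using x assms by (simp add: compositions_UNIV vsum_diff)
    show "vpow s z * (multinom (N - k) (x - z) * vpow (\<lambda>j. s j * p j) (x - z)) =
        multinom (N - k) (x - z) * vpow p (x - z) * vpow s x"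
      unfolding vpow_diff[OF x(2), of s] vpow_mult by simp
  qed auto
  then show ?thesis
    by (simp add: power_sum_eq_multinom sum_distrib_left)
qed

lemma finite_le_fun: "finite {z::'d::finite \<Rightarrow> nat. z \<le> x}"
proof (rule finite_subset)
  show "{z. z \<le> x} \<subseteq> {z. \<forall>j. (j \<in> UNIV \<longrightarrow> z j \<in> {..vsum x}) \<and> (j \<notin> UNIV \<longrightarrow> z j = 0)}"
  proof clarsimp
    fix z j assume "z \<le> x"
    then have "z j \<le> x j" by (simp add: le_fun_def)
    also have "x j \<le> vsum x" unfolding vsum_def by (rule member_le_sum) auto
    finally show "z j \<le> vsum x" .
  qed
qed (rule finite_set_of_finite_funs, auto)

text \<open>The range of \<open>z\<close> depends on \<open>x\<close> and \<open>y\<close>, so the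
  order constraints become conditionals over fixed index sets before the exchange.\<close>

lemma sum_Collect_le_swap:
  fixes f :: "('d::finite \<Rightarrow> nat) \<Rightarrow> ('d \<Rightarrow> nat) \<Rightarrow> ('d \<Rightarrow> nat) \<Rightarrow> real"
  shows "(\<Sum>x\<in>compositions UNIV N. \<Sum>y\<in>compositions UNIV N.
      \<Sum>z | z \<le> x \<and> z \<le> y \<and> vsum z = k. f x y z) =
    (\<Sum>z\<in>compositions UNIV k. \<Sum>x | x \<in> compositions UNIV N \<and> z \<le> x.
      \<Sum>y | y \<in> compositions UNIV N \<and> z \<le> y. f x y z)"
proof -
  note fin = finite_compositions[OF finite_class.finite_UNIV]
  have "(\<Sum>x\<in>compositions UNIV N. \<Sum>y\<in>compositions UNIV N.
      \<Sum>z | z \<le> x \<and> z \<le> y \<and> vsum z = k. f x y z) =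
    (\<Sum>x\<in>compositions UNIV N. \<Sum>y\<in>compositions UNIV N.
      \<Sum>z | z \<in> compositions UNIV k \<and> (z \<le> x \<and> z \<le> y). f x y z)"
    by (intro sum.cong) (auto simp: compositions_UNIV)
  also have "\<dots> = (\<Sum>x\<in>compositions UNIV N. \<Sum>y\<in>compositions UNIV N.
      \<Sum>z\<in>compositions UNIV k. if z \<le> x \<and> z \<le> y then f x y z else 0)"
    by (simp add: sum.inter_filter fin)
  also have "\<dots> = (\<Sum>z\<in>compositions UNIV k. \<Sum>x\<in>compositions UNIV N. \<Sum>y\<in>compositions UNIV N.
      if z \<le> x \<and> z \<le> y then f x y z else 0)"
    by (rule sum_swap_outer)
  also have "\<dots> = (\<Sum>z\<in>compositions UNIV k. \<Sum>x\<in>compositions UNIV N. if z \<le> x then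
      (\<Sum>y\<in>compositions UNIV N. if z \<le> y then f x y z else 0) else 0)"
    by (intro sum.cong) auto
  finally show ?thesis
    by (simp add: sum.inter_filter fin)
qed

text \<open>For a fixed common part \<open>z\<close> the sums over \<open>x\<close> and
  \<open>y\<close> separate, and each leaves its own monomial with exponent \<open>z\<close>.
  Together with the weight \<open>vpow p z\<close> these form the monomial in
  \<open>p j * s j * t j\<close>, and the sum over \<open>z\<close> is again a multinomial
  expansion.\<close>

lemma overlap_kernel_gf:
  fixes s t p :: "'d::finite \<Rightarrow> real"
  assumes "k \<le> N"
  shows "(\<Sum>x\<in>compositions UNIV N. \<Sum>y\<in>compositions UNIV N.
      overlap_kernel N p k x y * vpow s x * vpow t y) =
    (\<Sum>j\<in>UNIV. p j * s j * t j) ^ k *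
    ((\<Sum>j\<in>UNIV. s j * p j) * (\<Sum>j\<in>UNIV. t j * p j)) ^ (N - k)"
proof -
  let ?A = "compositions UNIV N :: ('d \<Rightarrow> nat) set"
  have "(\<Sum>x\<in>?A. \<Sum>y\<in>?A. overlap_kernel N p k x y * vpow s x * vpow t y) =
    (\<Sum>z\<in>compositions UNIV k. \<Sum>x | x \<in> ?A \<and> z \<le> x. \<Sum>y | y \<in> ?A \<and> z \<le> y.
      multinom k z * vpow p z * (multinom (N - k) (x - z) * vpow p (x - z)) *
      (multinom (N - k) (y - z) * vpow p (y - z)) * vpow s x * vpow t y)"
    unfolding overlap_kernel_def sum_distrib_right by (rule sum_Collect_le_swap)
  also have "\<dots> = (\<Sum>z\<in>compositions UNIV k. multinom k z * vpow p z *
      ((\<Sum>x | x \<in> ?A \<and> z \<le> x. multinom (N - k) (x - z) * vpow p (x - z) * vpow s x) *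
       (\<Sum>y | y \<in> ?A \<and> z \<le> y. multinom (N - k) (y - z) * vpow p (y - z) * vpow t y)))"
    unfolding sum_product unfolding sum_distrib_left by (intro sum.cong refl) (simp add: mult_ac)
  also have "\<dots> = (\<Sum>z\<in>compositions UNIV k. multinom k z * vpow (\<lambda>j. p j * s j * t j) z *
      ((\<Sum>j\<in>UNIV. s j * p j) * (\<Sum>j\<in>UNIV. t j * p j)) ^ (N - k))"
  proof (rule sum.cong[OF refl])
    fix z :: "'d \<Rightarrow> nat" assume "z \<in> compositions UNIV k"
    then have z: "vsum z = k" by (simp add: compositions_UNIV)
    show "multinom k z * vpow p z *
        ((\<Sum>x | x \<in> ?A \<and> z \<le> x. multinom (N - k) (x - z) * vpow p (x - z) * vpow s x) *
         (\<Sum>y | y \<in> ?A \<and> z \<le> y. multinom (N - k) (y - z) * vpow p (y - z) * vpow t y)) =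
      multinom k z * vpow (\<lambda>j. p j * s j * t j) z *
        ((\<Sum>j\<in>UNIV. s j * p j) * (\<Sum>j\<in>UNIV. t j * p j)) ^ (N - k)"
      unfolding sum_shifted_multinomial[OF z assms]
      by (simp only: vpow_mult power_mult_distrib mult_ac)
  qed
  also have "\<dots> = (\<Sum>z\<in>compositions UNIV k. multinom k z * vpow (\<lambda>j. p j * s j * t j) z) *
      ((\<Sum>j\<in>UNIV. s j * p j) * (\<Sum>j\<in>UNIV. t j * p j)) ^ (N - k)"
    by (rule sum_distrib_right[symmetric])
  finally show ?thesis by (simp only: power_sum_eq_multinom[symmetric])
qed

section \<open>Comparison of the kernels with combinations of \<open>overlap_kernel\<close>\<close>

lemma sum_scaled_gf:
  fixes F :: "'c \<Rightarrow> 'a \<Rightarrow> 'b \<Rightarrow> real"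
  shows "(\<Sum>x\<in>A. \<Sum>y\<in>B. (\<Sum>k\<in>K. c k * F k x y) * g x * h y) =
    (\<Sum>k\<in>K. c k * (\<Sum>x\<in>A. \<Sum>y\<in>B. F k x y * g x * h y))"
proof -
  have "(\<Sum>x\<in>A. \<Sum>y\<in>B. (\<Sum>k\<in>K. c k * F k x y) * g x * h y) =
    (\<Sum>x\<in>A. \<Sum>y\<in>B. \<Sum>k\<in>K. c k * (F k x y * g x * h y))"
    by (simp only: sum_distrib_right mult.assoc)
  also have "\<dots> = (\<Sum>k\<in>K. \<Sum>x\<in>A. \<Sum>y\<in>B. c k * (F k x y * g x * h y))"
    by (rule sum_swap_outer)
  finally show ?thesis by (simp only: sum_distrib_left)
qed

text \<open>The source of the signed coefficients in (b). After the binomial expansion of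
  \<open>(P - T) ^ n\<close>, choosing \<open>n\<close> out of \<open>N\<close> and then
  \<open>k\<close> out of those is recounted as choosing \<open>k\<close> first and completing it to
  \<open>n\<close>.\<close>

lemma shifted_binomial_expansion:
  fixes P T :: real
  assumes "n \<le> N"
  shows "real (N choose n) * T ^ (N - n) * (P - T) ^ n =
    (\<Sum>k\<le>n. real (N choose k) * real ((N - k) choose (n - k)) * (-1) ^ (n - k) *
      (P ^ k * T ^ (N - k)))"
proof -
  have expand: "(P - T) ^ n = (\<Sum>k\<le>n. real (n choose k) * P ^ k * (- T) ^ (n - k))"
    using binomial_ring[of P "- T" n] by simp
  have "real (N choose n) * T ^ (N - n) * (real (n choose k) * P ^ k * (- T) ^ (n - k)) =
    real (N choose k) * real ((N - k) choose (n - k)) * (-1) ^ (n - k) * (P ^ k * T ^ (N - k))"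
    if "k \<le> n" for k
  proof -
    have "T ^ (N - n) * (- T) ^ (n - k) = (-1) ^ (n - k) * T ^ (N - k)"
      unfolding power_minus[of T] using that assms
      by (simp add: mult.left_commute power_add[symmetric])
    moreover have "real (N choose n) * real (n choose k) = real (N choose k) * real ((N - k) choose (n - k))"
      using choose_mult[OF that assms] by (metis of_nat_mult)
    moreover have "real (N choose n) * T ^ (N - n) * (real (n choose k) * P ^ k * (- T) ^ (n - k)) =
      real (N choose n) * real (n choose k) * (T ^ (N - n) * (- T) ^ (n - k)) * P ^ k"
      by simp
    ultimately show ?thesis by simp
  qed
  then show ?thesis unfolding expand sum_distrib_left by (intro sum.cong) auto
qed

context
  fixes N :: nat and p :: "'d::finite \<Rightarrow> real" and u :: "nat \<Rightarrow> 'd \<Rightarrow> real"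
  assumes p: "\<And>j. p j > 0" and u: "orthonormal_system p u"
begin

text \<open>By \<open>shifted_binomial_expansion\<close> both sides have the same generating
  function in \<open>s\<close> and \<open>t\<close>, which determines its coefficients.\<close>

lemma kernel_poly_eq_overlap:
  assumes "n \<le> N" "vsum x = N" "vsum y = N"
  shows "multinomial_prob N p x * multinomial_prob N p y * kernel_poly N u n x y =
    (\<Sum>k\<le>n. real (N choose k) * real ((N - k) choose (n - k)) * (-1) ^ (n - k) *
      overlap_kernel N p k x y)"
proof -
  have gf: "(\<Sum>x\<in>compositions UNIV N. \<Sum>y\<in>compositions UNIV N.
      multinomial_prob N p x * multinomial_prob N p y * kernel_poly N u n x y * vpow s x * vpow t y) =
    (\<Sum>x\<in>compositions UNIV N. \<Sum>y\<in>compositions UNIV N.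
      (\<Sum>k\<le>n. real (N choose k) * real ((N - k) choose (n - k)) * (-1) ^ (n - k) *
        overlap_kernel N p k x y) * vpow s x * vpow t y)" for s t :: "'d \<Rightarrow> real"
    unfolding sum_scaled_gf kernel_poly_gf[OF u p \<open>n \<le> N\<close>] shifted_binomial_expansion[OF \<open>n \<le> N\<close>]
    by (intro sum.cong refl) (use \<open>n \<le> N\<close> in \<open>simp only: overlap_kernel_gf atMost_iff le_trans\<close>)
  show ?thesis
    by (rule bivariate_coeffs_eqI[OF _ gf])
      (use assms in \<open>simp_all add: finite_vsum_eq compositions_UNIV\<close>)
qed

lemma kernel_poly_power_gf:
  "(\<Sum>x\<in>compositions UNIV N. \<Sum>y\<in>compositions UNIV N. (\<Sum>n\<le>N. \<rho> ^ n *
      (multinomial_prob N p x * multinomial_prob N p y * kernel_poly N u n x y)) * vpow s x * vpow t y) =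
    (\<rho> * (\<Sum>j\<in>UNIV. p j * s j * t j) +
      (1 - \<rho>) * ((\<Sum>j\<in>UNIV. s j * p j) * (\<Sum>j\<in>UNIV. t j * p j))) ^ N"
proof -
  have "(\<Sum>n\<le>N. \<rho> ^ n * (real (N choose n) * T ^ (N - n) * (P - T) ^ n)) =
      (\<rho> * P + (1 - \<rho>) * T) ^ N" for P T :: real
  proof -
    \<comment> \<open>With the base in this form, the sum over \<open>n\<close> is its binomial
      expansion.\<close>
    have "\<rho> * P + (1 - \<rho>) * T = \<rho> * (P - T) + T" by (simp add: algebra_simps)
    then show ?thesis by (simp only: binomial_ring) (simp add: power_mult_distrib mult_ac)
  qed
  note expand = this[symmetric]
  show ?thesis
    unfolding sum_scaled_gf expand
    by (intro sum.cong refl) (simp only: kernel_poly_gf[OF u p] atMost_iff)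
qed

text \<open>The closed form in \<open>kernel_poly_power_gf\<close> is expanded once more, now in
  powers of its two summands; each mixed product is, up to a constant, the generating function of an
  \<open>overlap_kernel\<close>.\<close>

lemma kernel_poly_power_eq_overlap:
  assumes "vsum x = N" "vsum y = N"
  shows "(\<Sum>n\<le>N. \<rho> ^ n *
      (multinomial_prob N p x * multinomial_prob N p y * kernel_poly N u n x y)) =
    (\<Sum>k\<le>N. real (N choose k) * \<rho> ^ k * (1 - \<rho>) ^ (N - k) * overlap_kernel N p k x y)"
proof -
  have gf: "(\<Sum>x\<in>compositions UNIV N. \<Sum>y\<in>compositions UNIV N. (\<Sum>n\<le>N. \<rho> ^ n *
      (multinomial_prob N p x * multinomial_prob N p y * kernel_poly N u n x y)) * vpow s x * vpow t y) =
    (\<Sum>x\<in>compositions UNIV N. \<Sum>y\<in>compositions UNIV N. (\<Sum>k\<le>N. real (N choose k) * \<rho> ^ k *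
      (1 - \<rho>) ^ (N - k) * overlap_kernel N p k x y) * vpow s x * vpow t y)" for s t :: "'d \<Rightarrow> real"
    unfolding sum_scaled_gf[where c = "\<lambda>k. real (N choose k) * \<rho> ^ k * (1 - \<rho>) ^ (N - k)"]
      kernel_poly_power_gf binomial_ring
    by (intro sum.cong refl)
      (simp only: overlap_kernel_gf atMost_iff, simp only: power_mult_distrib mult_ac)
  show ?thesis
    by (rule bivariate_coeffs_eqI[OF _ gf])
      (use assms in \<open>simp_all add: finite_vsum_eq compositions_UNIV\<close>)
qed

text \<open>Expanding the generating function over pairs of indices has coefficients
  \<open>(1 - \<rho>) * p i * p j + (if i = j then \<rho> * p i else 0)\<close>, which the bounds on \<open>\<rho>\<close> make
  non-negative.\<close>

lemma kernel_poly_power_nonneg: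
  assumes x: "vsum x = N" and y: "vsum y = N"
    and \<rho>: "\<rho> \<le> 1" "\<And>i. 0 \<le> (1 - \<rho>) * p i + \<rho>"
  shows "0 \<le> (\<Sum>n\<le>N. \<rho> ^ n *
      (multinomial_prob N p x * multinomial_prob N p y * kernel_poly N u n x y))"
proof -
  define c where "c = (\<lambda>(i, j). (1 - \<rho>) * p i * p j + (if i = j then \<rho> * p i else 0))"
  have c: "c q \<ge> 0" for q
  proof (cases q)
    case (Pair i j)
    show ?thesis
    proof (cases "i = j")
      case True
      have "c q = p i * ((1 - \<rho>) * p i + \<rho>)"
        using True Pair by (simp add: c_def algebra_simps)
      then show ?thesis using \<rho>(2) p[of i] by simp
    next
      case False
      then show ?thesis using Pair \<rho>(1) p[of i] p[of j] by (simp add: c_def)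
    qed
  qed
  \<comment> \<open>A composition of \<open>N\<close> over pairs is a table of counts, and
    \<open>row\<close> and \<open>col\<close> are its margins.\<close>
  define row col :: "('d \<times> 'd \<Rightarrow> nat) \<Rightarrow> 'd \<Rightarrow> nat"
    where "row k i = (\<Sum>j\<in>UNIV. k (i, j))" and "col k j = (\<Sum>i\<in>UNIV. k (i, j))" for k i j
  define K :: "('d \<times> 'd \<Rightarrow> nat) set" where "K = compositions UNIV N"
  \<comment> \<open>The tables with margins \<open>x\<close> and \<open>y\<close> are those that
    contribute the monomial of \<open>x\<close> in \<open>s\<close> and of \<open>y\<close> in
    \<open>t\<close>.\<close>
  define H where "H x y = (\<Sum>k | k \<in> K \<and> row k = x \<and> col k = y. multinom N k * vpow c k)" for x y
  have finK: "finite K" by (simp add: K_def finite_compositions)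
  have sum_pairs: "(\<Sum>q\<in>UNIV. g q) = (\<Sum>i\<in>UNIV. \<Sum>j\<in>UNIV. g (i, j))"
    for g :: "'d \<times> 'd \<Rightarrow> 'b::comm_monoid_add"
    using sum.cartesian_product[of "\<lambda>i j. g (i, j)" UNIV UNIV] by (simp add: case_prod_unfold)
  have prod_pairs: "(\<Prod>q\<in>UNIV. g q) = (\<Prod>i\<in>UNIV. \<Prod>j\<in>UNIV. g (i, j))" for g :: "'d \<times> 'd \<Rightarrow> real"
    using prod.cartesian_product[of "\<lambda>i j. g (i, j)" UNIV UNIV] by (simp add: case_prod_unfold)
  have row_col: "row k \<in> compositions UNIV N" "col k \<in> compositions UNIV N" if "k \<in> K" for k
  proof -
    have "(\<Sum>i\<in>UNIV. \<Sum>j\<in>UNIV. k (i, j)) = N"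
      using that by (simp add: K_def compositions_def sum_pairs)
    then show "row k \<in> compositions UNIV N" "col k \<in> compositions UNIV N"
      using sum.swap[of "\<lambda>i j. k (i, j)" UNIV UNIV]
      by (simp_all add: compositions_def row_def[abs_def] col_def[abs_def])
  qed
  have marginals: "vpow (\<lambda>(i, j). s i * t j) k = vpow s (row k) * vpow t (col k)"
    for k and s t :: "'d \<Rightarrow> real"
  proof -
    have "vpow (\<lambda>(i, j). s i * t j) k =
        (\<Prod>i\<in>UNIV. \<Prod>j\<in>UNIV. s i ^ k (i, j)) * (\<Prod>i\<in>UNIV. \<Prod>j\<in>UNIV. t j ^ k (i, j))"
      unfolding vpow_def prod_pairs by (simp add: power_mult_distrib prod.distrib)
    also have "(\<Prod>i\<in>UNIV. \<Prod>j\<in>UNIV. t j ^ k (i, j)) = (\<Prod>j\<in>UNIV. \<Prod>i\<in>UNIV. t j ^ k (i, j))"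
      by (rule prod.swap)
    finally show ?thesis by (simp add: vpow_def row_def col_def power_sum)
  qed
  have gf: "(\<Sum>x\<in>compositions UNIV N. \<Sum>y\<in>compositions UNIV N. (\<Sum>n\<le>N. \<rho> ^ n *
        (multinomial_prob N p x * multinomial_prob N p y * kernel_poly N u n x y)) * vpow s x * vpow t y) =
      (\<Sum>x\<in>compositions UNIV N. \<Sum>y\<in>compositions UNIV N. H x y * vpow s x * vpow t y)"
    for s t :: "'d \<Rightarrow> real"
  proof -
    have "\<rho> * (\<Sum>j\<in>UNIV. p j * s j * t j) +
        (1 - \<rho>) * ((\<Sum>j\<in>UNIV. s j * p j) * (\<Sum>j\<in>UNIV. t j * p j)) =
        (\<Sum>i\<in>UNIV. \<Sum>j\<in>UNIV. c (i, j) * (s i * t j))"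
    proof -
      have "(\<Sum>j\<in>UNIV. c (i, j) * (s i * t j)) =
          (1 - \<rho>) * (s i * p i * (\<Sum>j\<in>UNIV. t j * p j)) + \<rho> * (p i * s i * t i)" for i
      proof -
        have "(\<Sum>j\<in>UNIV. c (i, j) * (s i * t j)) = (\<Sum>j\<in>UNIV. (1 - \<rho>) * (s i * p i * (t j * p j)) +
            (if i = j then \<rho> * (p i * s i * t i) else 0))"
          by (intro sum.cong) (auto simp: c_def algebra_simps)
        then show ?thesis by (simp add: sum.distrib sum_distrib_left)
      qed
      then show ?thesis
        by (simp add: sum.distrib sum_distrib_left[symmetric] sum_distrib_right[symmetric])
    qed
    also have "\<dots> = (\<Sum>q\<in>UNIV. c q * (case q of (i, j) \<Rightarrow> s i * t j))"
      by (simp add: sum_pairs)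
    finally have base: "\<rho> * (\<Sum>j\<in>UNIV. p j * s j * t j) +
        (1 - \<rho>) * ((\<Sum>j\<in>UNIV. s j * p j) * (\<Sum>j\<in>UNIV. t j * p j)) =
        (\<Sum>q\<in>UNIV. c q * (case q of (i, j) \<Rightarrow> s i * t j))" .
    have "(\<rho> * (\<Sum>j\<in>UNIV. p j * s j * t j) +
        (1 - \<rho>) * ((\<Sum>j\<in>UNIV. s j * p j) * (\<Sum>j\<in>UNIV. t j * p j))) ^ N =
        (\<Sum>k\<in>K. multinom N k * vpow c k * vpow s (row k) * vpow t (col k))"
      unfolding base by (simp only: power_sum_eq_multinom K_def[symmetric] vpow_mult marginals mult.assoc)
    also have "\<dots> = (\<Sum>x\<in>compositions UNIV N. \<Sum>k | k \<in> K \<and> row k = x.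
        multinom N k * vpow c k * vpow s (row k) * vpow t (col k))"
      using row_col by (intro sum.group[symmetric] finK finite_compositions) auto
    also have "\<dots> = (\<Sum>x\<in>compositions UNIV N. \<Sum>y\<in>compositions UNIV N.
        \<Sum>k | k \<in> {k. k \<in> K \<and> row k = x} \<and> col k = y.
        multinom N k * vpow c k * vpow s (row k) * vpow t (col k))"
      using row_col finK by (intro sum.cong refl sum.group[symmetric] finite_compositions) auto
    also have "\<dots> = (\<Sum>x\<in>compositions UNIV N. \<Sum>y\<in>compositions UNIV N. H x y * vpow s x * vpow t y)"
      unfolding H_def sum_distrib_right by (intro sum.cong) auto
    finally show ?thesis unfolding kernel_poly_power_gf .
  qed
  have "(\<Sum>n\<le>N. \<rho> ^ n *
      (multinomial_prob N p x * multinomial_prob N p y * kernel_poly N u n x y)) = H x y"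
    by (rule bivariate_coeffs_eqI[OF _ gf])
      (use x y in \<open>simp_all add: finite_vsum_eq compositions_UNIV\<close>)
  also have "H x y \<ge> 0"
    unfolding H_def multinom_def vpow_def using c
    by (intro sum_nonneg mult_nonneg_nonneg prod_nonneg)
      (auto intro!: divide_nonneg_nonneg prod_nonneg)
  finally show ?thesis .
qed

end

section \<open>Expectations and explicit formulas\<close>

text \<open>The density has finite support, so every real function of \<open>X\<close> is integrable
  and its integral is a finite sum. Positivity of \<open>p\<close> makes the density non-negative,
  so that passing through \<open>ennreal\<close> loses nothing.\<close>

lemma (in prob_space) multinomial_distributed_integral:
  fixes X :: "'a \<Rightarrow> 'd::finite \<Rightarrow> nat" and g :: "('d \<Rightarrow> nat) \<Rightarrow> real"
  assumes X: "multinomial_distributed M N p X" and p: "\<And>j. p j > 0"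
  shows "integrable M (\<lambda>\<omega>. g (X \<omega>))"
    and "expectation (\<lambda>\<omega>. g (X \<omega>)) = (\<Sum>x\<in>compositions UNIV N. multinomial_prob N p x * g x)"
proof -
  let ?f = "\<lambda>x. if vsum x = N then multinomial_prob N p x else 0"
  have f: "0 \<le> ?f x" for x
    using p by (simp add: multinomial_prob_def multinom_def prod_nonneg less_imp_le)
  note D = X[unfolded multinomial_distributed_def]
  have fin: "finite (compositions UNIV N :: ('d \<Rightarrow> nat) set)"
    by (simp add: finite_compositions)
  have "integrable (count_space UNIV) (\<lambda>x. ?f x * g x)"
  proof -
    have "integrable (count_space UNIV)
        (\<lambda>x. \<Sum>y\<in>compositions UNIV N. indicator {y} x * (multinomial_prob N p y * g y))"
      by (intro Bochner_Integration.integrable_sum integrable_mult_left) auto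
    moreover have "(\<Sum>y\<in>compositions UNIV N. indicator {y} x * (multinomial_prob N p y * g y)) = ?f x * g x"
      for x :: "'d \<Rightarrow> nat"
      using fin by (simp add: indicator_def of_bool_def if_distrib[of "\<lambda>x. x * _"] compositions_UNIV cong: if_cong)
    ultimately show ?thesis by simp
  qed
  then show "integrable M (\<lambda>\<omega>. g (X \<omega>))"
    using distributed_integrable[OF D, of g] f by simp
  have "expectation (\<lambda>\<omega>. g (X \<omega>)) = (\<integral>x. ?f x * g x \<partial>count_space UNIV)"
    using distributed_integral[OF D, of g] f by simp
  also have "\<dots> = (\<Sum>x\<in>compositions UNIV N. ?f x * g x)"
  proof -
    have "finite {x. ?f x * g x \<noteq> 0}"
      by (rule finite_subset[OF _ finite_vsum_eq[of N]]) (auto split: if_splits)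
    then show ?thesis
      by (subst lebesgue_integral_count_space_finite_support)
        (auto intro!: sum.mono_neutral_left simp: finite_vsum_eq compositions_UNIV split: if_splits)
  qed
  finally show "expectation (\<lambda>\<omega>. g (X \<omega>)) = (\<Sum>x\<in>compositions UNIV N. multinomial_prob N p x * g x)"
    by (simp add: compositions_UNIV)
qed

text \<open>Each summand of the kernel is a function of \<open>X\<close> times a function of
  \<open>Y\<close>. By independence its expectation is a product of two finite sums, and
  \<open>sum_multinomial_kernel\<close> evaluates the total.\<close>

lemma (in prob_space) expectation_kernel_poly:
  fixes X Y :: "'a \<Rightarrow> 'd::finite \<Rightarrow> nat" and u :: "nat \<Rightarrow> 'd \<Rightarrow> real"
  assumes X: "multinomial_distributed M N p X" and Y: "multinomial_distributed M N p Y"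
    and ind: "indep_var (count_space UNIV) X (count_space UNIV) Y"
    and p: "\<And>j. p j > 0" and u: "orthonormal_system p u" and n: "n \<le> N"
  shows "expectation (\<lambda>\<omega>. vpow s (X \<omega>) * vpow t (Y \<omega>) * kernel_poly N u n (X \<omega>) (Y \<omega>)) =
    real (N choose n) * ((\<Sum>j\<in>UNIV. s j * p j) * (\<Sum>j\<in>UNIV. t j * p j)) ^ (N - n) *
    ((\<Sum>j\<in>UNIV. p j * s j * t j) - (\<Sum>j\<in>UNIV. s j * p j) * (\<Sum>j\<in>UNIV. t j * p j)) ^ n"
proof -
  define g where "g s k x = vpow s x * krawtchouk u k x" for s k and x :: "'d \<Rightarrow> nat"
  note g_int = multinomial_distributed_integral[OF X p, where g = "g _ _"]
    multinomial_distributed_integral[OF Y p, where g = "g _ _"]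
  have ind_g: "indep_var borel (\<lambda>\<omega>. g s k (X \<omega>)) borel (\<lambda>\<omega>. g t k (Y \<omega>))" for k
    using indep_var_compose[OF ind, of "g s k" borel "g t k" borel] by (simp add: o_def)
  have "expectation (\<lambda>\<omega>. vpow s (X \<omega>) * vpow t (Y \<omega>) * kernel_poly N u n (X \<omega>) (Y \<omega>)) =
    expectation (\<lambda>\<omega>. \<Sum>k\<in>multiindices CARD('d) n.
      g s k (X \<omega>) * g t k (Y \<omega>) / krawtchouk_norm2 CARD('d) N k)"
    by (simp add: kernel_poly_eq g_def sum_distrib_left mult_ac)
  also have "\<dots> = (\<Sum>k\<in>multiindices CARD('d) n.
      expectation (\<lambda>\<omega>. g s k (X \<omega>)) * expectation (\<lambda>\<omega>. g t k (Y \<omega>)) / krawtchouk_norm2 CARD('d) N k)"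
    using indep_var_integrable[OF ind_g] indep_var_lebesgue_integral[OF ind_g] g_int
    by (subst Bochner_Integration.integral_sum) auto
  finally show ?thesis
    unfolding g_int unfolding g_def sum_multinomial_kernel[OF u p n] .
qed

section \<open>Falling factorials and the explicit form of the overlap kernels\<close>

lemma multinomial_prob_pos:
  assumes "\<And>j. p j > 0"
  shows "multinomial_prob N p x > 0"
  using assms by (auto simp: multinomial_prob_def multinom_def intro!: mult_pos_pos divide_pos_pos prod_pos)

lemma falling_eq_fact: "k \<le> n \<Longrightarrow> falling n k = fact n / fact (n - k)"
proof (induction k)
  case 0
  then show ?case by (simp add: falling_def)
next
  case (Suc k)
  then have "fact (n - k) = (real n - real k) * fact (n - Suc k)"
    by (simp add: Suc_diff_Suc[symmetric] of_nat_diff)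
  moreover have "falling n (Suc k) = falling n k * (real n - real k)"
    by (simp add: falling_def)
  ultimately show ?case using Suc by simp
qed

lemma multinom_rest_eq:
  "vsum z \<le> N \<Longrightarrow> multinom_rest N z = real (N choose vsum z) * multinom (vsum z) z"
  by (simp add: multinom_rest_def multinom_def binomial_fact)

text \<open>Writing each \<open>fact (x j - z j)\<close> as \<open>fact (x j)\<close> over a falling
  factorial, and \<open>fact (N - vsum z)\<close> likewise, recovers the factorials of
  \<open>multinomial_prob N p x\<close>; the weight of \<open>z\<close> is divided out.\<close>

lemma multinomial_prob_split:
  assumes "vsum x = N" "z \<le> x" "\<And>j. p j > 0"
  shows "multinom (N - vsum z) (x - z) * vpow p (x - z) = multinomial_prob N p x *
    ((\<Prod>j\<in>UNIV. falling (x j) (z j)) / (vpow p z * falling N (vsum z)))"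
proof -
  have "(\<Prod>j\<in>UNIV. falling (x j) (z j)) = (\<Prod>j\<in>UNIV. fact (x j)) / (\<Prod>j\<in>UNIV. fact (x j - z j))"
    using assms(2) by (simp add: falling_eq_fact le_fun_def prod_dividef)
  moreover have "falling N (vsum z) = fact N / fact (N - vsum z)"
    using vsum_mono[OF assms(2)] assms(1) by (simp add: falling_eq_fact)
  moreover have "multinomial_prob N p x = fact N / (\<Prod>j\<in>UNIV. fact (x j)) * (vpow p z * vpow p (x - z))"
    using vpow_diff[OF assms(2), of p] by (simp add: multinomial_prob_def multinom_def vpow_def)
  moreover have "vpow p z \<noteq> 0" using vpow_pos[of p z] assms(3) by simp
  moreover have "(\<Prod>j\<in>UNIV. fact (x j) :: real) \<noteq> 0" by simp
  ultimately show ?thesis by (simp add: multinom_def)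
qed

text \<open>Splitting off \<open>z\<close> from \<open>x\<close> and from \<open>y\<close> brings in
  \<open>1 / vpow p z\<close> twice. One copy cancels the weight of the common part, which leaves a
  single negative power of each \<open>p j\<close>.\<close>

lemma overlap_kernel_eq:
  assumes "vsum x = N" "vsum y = N" and p: "\<And>j. p j > 0"
  shows "overlap_kernel N p k x y = multinomial_prob N p x * multinomial_prob N p y *
    (\<Sum>z | z \<le> x \<and> z \<le> y \<and> vsum z = k. multinom k z *
      ((\<Prod>j\<in>UNIV. falling (x j) (z j) * falling (y j) (z j) * p j powi (- int (z j))) /
        (falling N k)\<^sup>2))"
  unfolding overlap_kernel_def sum_distrib_left
proof (intro sum.cong refl)
  fix z assume "z \<in> {z. z \<le> x \<and> z \<le> y \<and> vsum z = k}"
  then have z: "z \<le> x" "z \<le> y" "vsum z = k" by auto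
  have "(\<Prod>j\<in>UNIV. p j powi (- int (z j))) = 1 / vpow p z"
    by (simp add: vpow_def power_int_minus inverse_eq_divide prod_dividef)
  then show "multinom k z * vpow p z * (multinom (N - k) (x - z) * vpow p (x - z)) *
      (multinom (N - k) (y - z) * vpow p (y - z)) =
    multinomial_prob N p x * multinomial_prob N p y * (multinom k z *
      ((\<Prod>j\<in>UNIV. falling (x j) (z j) * falling (y j) (z j) * p j powi (- int (z j))) /
        (falling N k)\<^sup>2))"
    using multinomial_prob_split[where p = p, OF assms(1) z(1) p]
      multinomial_prob_split[where p = p, OF assms(2) z(2) p]
      vpow_pos[of p z, OF p] z(3)
    by (simp add: prod.distrib power2_eq_square mult_ac)
qed

lemma sum_by_vsum:
  fixes f :: "('d::finite \<Rightarrow> nat) \<Rightarrow> real"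
  shows "(\<Sum>k\<le>n. \<Sum>z | z \<le> x \<and> z \<le> y \<and> vsum z = k. f z) =
    (\<Sum>z | z \<le> x \<and> z \<le> y \<and> vsum z \<le> n. f z)"
proof -
  have "(\<Sum>k\<le>n. \<Sum>z | z \<in> {z. z \<le> x \<and> z \<le> y \<and> vsum z \<le> n} \<and> vsum z = k. f z) =
    (\<Sum>z | z \<le> x \<and> z \<le> y \<and> vsum z \<le> n. f z)"
    by (rule sum.group) (auto intro: finite_subset[OF _ finite_le_fun[of x]])
  moreover have "{z. z \<in> {z. z \<le> x \<and> z \<le> y \<and> vsum z \<le> n} \<and> vsum z = k} =
    {z. z \<le> x \<and> z \<le> y \<and> vsum z = k}" if "k \<le> n" for k
    using that by auto
  ultimately show ?thesis by simp
qed

theorem theorem1: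
  fixes N :: nat and p :: "'d::finite \<Rightarrow> real" and u :: "nat \<Rightarrow> 'd \<Rightarrow> real"
  assumes "N \<ge> 1" and "CARD('d) \<ge> 2"
    and "\<And>j. p j > 0" and "(\<Sum>j\<in>UNIV. p j) = 1"
    and "orthonormal_system p u"
  shows
    "(\<forall>x y :: 'd \<Rightarrow> nat. vsum x = N \<and> vsum y = N \<longrightarrow>
       (\<forall>\<rho>::real.
          1 + (\<Sum>n=1..N. \<rho> ^ n * kernel_poly N u n x y) =
          inverse (multinomial_prob N p x) * inverse (multinomial_prob N p y) *
          (\<Sum>z | z \<le> x \<and> z \<le> y.
             \<rho> ^ vsum z * (1 - \<rho>) ^ (N - vsum z) *
             multinom_rest N z * (\<Prod>i\<in>UNIV. p i ^ z i) *
             (multinom (N - vsum z) (x - z) * (\<Prod>i\<in>UNIV. p i ^ (x i - z i))) *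
             (multinom (N - vsum z) (y - z) * (\<Prod>i\<in>UNIV. p i ^ (y i - z i))))
          \<and>
          (- (1 / (1 / Min (range p) - 1)) \<le> \<rho> \<and> \<rho> \<le> 1 \<longrightarrow>
             0 \<le> 1 + (\<Sum>n=1..N. \<rho> ^ n * kernel_poly N u n x y)))
       \<and>
       (\<forall>n\<le>N.
          kernel_poly N u n x y =
          (\<Sum>z | z \<le> x \<and> z \<le> y \<and> vsum z \<le> n.
             real (N choose vsum z) * real ((N - vsum z) choose (n - vsum z)) *
             (- 1) ^ (n - vsum z) * multinom (vsum z) z *
             ((\<Prod>j\<in>UNIV. falling (x j) (z j) * falling (y j) (z j) * p j powi (- int (z j))) /
              (falling N (vsum z))\<^sup>2))))
     \<and>
     (\<forall>(M :: 'w measure) X Y.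
        prob_space M \<and> multinomial_distributed M N p X \<and> multinomial_distributed M N p Y \<and>
        prob_space.indep_var M (count_space UNIV) X (count_space UNIV) Y \<longrightarrow>
        (\<forall>n\<le>N. \<forall>s t :: 'd \<Rightarrow> real.
          prob_space.expectation M
            (\<lambda>\<omega>. (\<Prod>i\<in>UNIV. s i ^ X \<omega> i) * (\<Prod>j\<in>UNIV. t j ^ Y \<omega> j) *
                  kernel_poly N u n (X \<omega>) (Y \<omega>)) =
          real (N choose n) *
          ((\<Sum>i\<in>UNIV. s i * p i) * (\<Sum>i\<in>UNIV. t i * p i)) ^ (N - n) *
          ((\<Sum>j\<in>UNIV. p j * s j * t j) -
             (\<Sum>i\<in>UNIV. s i * p i) * (\<Sum>i\<in>UNIV. t i * p i)) ^ n))"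
proof (intro conjI allI impI; (elim conjE)?)
  fix x y :: "'d \<Rightarrow> nat" and \<rho> :: real
  assume x: "vsum x = N" and y: "vsum y = N"
  note p = assms(3) and u = assms(5)
  let ?mx = "multinomial_prob N p x" and ?my = "multinomial_prob N p y"
  have m: "?mx > 0" "?my > 0" using multinomial_prob_pos p by auto
  \<comment> \<open>The series in (a) has its constant term written as 1, so the kernel of index 0
    must be evaluated; only \<open>z = 0\<close> contributes to it.\<close>
  have "{z. z \<le> x \<and> z \<le> y \<and> (\<forall>j. z j = 0)} = {\<lambda>_. 0}"
    by (auto simp: le_fun_def fun_eq_iff)
  then have kernel_0: "kernel_poly N u 0 x y = 1"
    using kernel_poly_eq_overlap[OF p u _ x y, of 0] overlap_kernel_eq[of x N y p 0, OF x y p] m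
    by (simp add: vsum_def falling_def multinom_def)
  \<comment> \<open>Both claims of (a) are obtained after multiplication by the positive weight
    \<open>?mx * ?my\<close>, which is divided out at the end.\<close>
  have series: "?mx * ?my * (1 + (\<Sum>n=1..N. \<rho> ^ n * kernel_poly N u n x y)) =
      (\<Sum>n\<le>N. \<rho> ^ n * (?mx * ?my * kernel_poly N u n x y))"
  proof -
    have "{..N} = insert 0 {1..N}" by auto
    then show ?thesis by (simp add: kernel_0 sum_distrib_left distrib_left mult_ac)
  qed
  have "(\<Sum>k\<le>N. real (N choose k) * \<rho> ^ k * (1 - \<rho>) ^ (N - k) * overlap_kernel N p k x y) =
    (\<Sum>k\<le>N. \<Sum>z | z \<le> x \<and> z \<le> y \<and> vsum z = k.
             \<rho> ^ vsum z * (1 - \<rho>) ^ (N - vsum z) *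
             multinom_rest N z * vpow p z *
             (multinom (N - vsum z) (x - z) * vpow p (x - z)) *
             (multinom (N - vsum z) (y - z) * vpow p (y - z)))"
    unfolding overlap_kernel_def sum_distrib_left
    by (intro sum.cong refl) (auto simp: multinom_rest_eq)
  \<comment> \<open>Sorting by size reaches every \<open>z\<close>, because \<open>z \<le> x\<close>
    gives \<open>vsum z \<le> N\<close>.\<close>
  also have "\<dots> = (\<Sum>z | z \<le> x \<and> z \<le> y.
             \<rho> ^ vsum z * (1 - \<rho>) ^ (N - vsum z) *
             multinom_rest N z * vpow p z *
             (multinom (N - vsum z) (x - z) * vpow p (x - z)) *
             (multinom (N - vsum z) (y - z) * vpow p (y - z)))"
    unfolding sum_by_vsum using vsum_mono x by (intro sum.cong) fastforce+
  finally have "?mx * ?my * (1 + (\<Sum>n=1..N. \<rho> ^ n * kernel_poly N u n x y)) = \<dots>"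
    unfolding series kernel_poly_power_eq_overlap[OF p u x y] .
  then show "1 + (\<Sum>n=1..N. \<rho> ^ n * kernel_poly N u n x y) =
          inverse (multinomial_prob N p x) * inverse (multinomial_prob N p y) *
          (\<Sum>z | z \<le> x \<and> z \<le> y.
             \<rho> ^ vsum z * (1 - \<rho>) ^ (N - vsum z) *
             multinom_rest N z * (\<Prod>i\<in>UNIV. p i ^ z i) *
             (multinom (N - vsum z) (x - z) * (\<Prod>i\<in>UNIV. p i ^ (x i - z i))) *
             (multinom (N - vsum z) (y - z) * (\<Prod>i\<in>UNIV. p i ^ (y i - z i))))"
    using m unfolding vpow_def fun_diff_def by (simp add: field_simps)
  assume lower: "- (1 / (1 / Min (range p) - 1)) \<le> \<rho>" and upper: "\<rho> \<le> 1"
  \<comment> \<open>As \<open>1 - \<rho>\<close> is non-negative, the smallest probability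
    \<open>q\<close> is the worst case. For it the inequality is the lower bound on
    \<open>\<rho>\<close> multiplied by \<open>1 - q\<close>.\<close>
  have "0 \<le> (1 - \<rho>) * p i + \<rho>" for i
  proof -
    define q where "q = Min (range p)"
    have "q \<in> range p" unfolding q_def by (rule Min_in) auto
    then have q0: "q > 0" using p by auto
    have q_le: "q \<le> p i" unfolding q_def by (rule Min_le) auto
    \<comment> \<open>Two distinct indices have positive probabilities with sum at most 1, so the
      minimum is below 1 and the bound on \<open>\<rho>\<close> has a positive denominator.\<close>
    have "q < 1"
    proof -
      obtain j k :: 'd where "j \<noteq> k"
        using assms(2) card_le_Suc0_iff_eq[of "UNIV :: 'd set"] by fastforce
      have "(\<Sum>l\<in>{j, k}. p l) \<le> (\<Sum>l\<in>UNIV. p l)"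
        using p by (intro sum_mono2) (auto simp: less_imp_le)
      then have "p j + p k \<le> 1" using \<open>j \<noteq> k\<close> assms(4) by simp
      moreover have "q \<le> p j" unfolding q_def by (rule Min_le) auto
      ultimately show ?thesis using p[of k] by linarith
    qed
    have "1 / (1 / q - 1) = q / (1 - q)" using q0 \<open>q < 1\<close> by (simp add: field_simps)
    then have "- (q / (1 - q)) \<le> \<rho>" using lower by (simp add: q_def)
    then have "- q \<le> \<rho> * (1 - q)" using \<open>q < 1\<close> by (simp add: field_simps)
    then have "0 \<le> (1 - \<rho>) * q + \<rho>" by (simp add: algebra_simps)
    also have "\<dots> \<le> (1 - \<rho>) * p i + \<rho>" using q_le upper by (simp add: mult_left_mono)
    finally show ?thesis .
  qed
  from kernel_poly_power_nonneg[OF p u x y upper this]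
  have "0 \<le> ?mx * ?my * (1 + (\<Sum>n=1..N. \<rho> ^ n * kernel_poly N u n x y))"
    unfolding series .
  then show "0 \<le> 1 + (\<Sum>n=1..N. \<rho> ^ n * kernel_poly N u n x y)"
    using mult_pos_pos[OF m] by (simp add: zero_le_mult_iff)
next
  fix x y :: "'d \<Rightarrow> nat" and n
  assume x: "vsum x = N" and y: "vsum y = N" and n: "n \<le> N"
  note p = assms(3) and u = assms(5)
  let ?mx = "multinomial_prob N p x" and ?my = "multinomial_prob N p y"
  \<comment> \<open>\<open>F z\<close> collects the factors of the summand that do not depend on
    \<open>n\<close>.\<close>
  define F where "F z = multinom (vsum z) z *
    ((\<Prod>j\<in>UNIV. falling (x j) (z j) * falling (y j) (z j) * p j powi (- int (z j))) /
      (falling N (vsum z))\<^sup>2)" for z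
  have "overlap_kernel N p k x y = ?mx * ?my * (\<Sum>z | z \<le> x \<and> z \<le> y \<and> vsum z = k. F z)" for k
    unfolding overlap_kernel_eq[of x N y p, OF x y p] F_def
    by (intro arg_cong[where f = "\<lambda>a. _ * a"] sum.cong) auto
  then have "?mx * ?my * kernel_poly N u n x y =
    ?mx * ?my * (\<Sum>k\<le>n. \<Sum>z | z \<le> x \<and> z \<le> y \<and> vsum z = k.
      real (N choose vsum z) * real ((N - vsum z) choose (n - vsum z)) * (- 1) ^ (n - vsum z) * F z)"
    unfolding kernel_poly_eq_overlap[OF p u n x y] sum_distrib_left
    by (intro sum.cong) (auto simp: sum_distrib_left mult_ac)
  moreover have "?mx * ?my \<noteq> 0" using multinomial_prob_pos[of p N, OF p] by (metis less_irrefl mult_pos_pos)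
  ultimately show "kernel_poly N u n x y =
          (\<Sum>z | z \<le> x \<and> z \<le> y \<and> vsum z \<le> n.
             real (N choose vsum z) * real ((N - vsum z) choose (n - vsum z)) *
             (- 1) ^ (n - vsum z) * multinom (vsum z) z *
             ((\<Prod>j\<in>UNIV. falling (x j) (z j) * falling (y j) (z j) * p j powi (- int (z j))) /
              (falling N (vsum z))\<^sup>2))"
    unfolding sum_by_vsum F_def by (simp add: mult.assoc)
next
  fix M :: "'w measure" and X Y n and s t :: "'d \<Rightarrow> real"
  assume M: "prob_space M" and X: "multinomial_distributed M N p X"
    and Y: "multinomial_distributed M N p Y"
    and ind: "prob_space.indep_var M (count_space UNIV) X (count_space UNIV) Y" and n: "n \<le> N"
  show "prob_space.expectation M
            (\<lambda>\<omega>. (\<Prod>i\<in>UNIV. s i ^ X \<omega> i) * (\<Prod>j\<in>UNIV. t j ^ Y \<omega> j) *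
                  kernel_poly N u n (X \<omega>) (Y \<omega>)) =
          real (N choose n) *
          ((\<Sum>i\<in>UNIV. s i * p i) * (\<Sum>i\<in>UNIV. t i * p i)) ^ (N - n) *
          ((\<Sum>j\<in>UNIV. p j * s j * t j) -
             (\<Sum>i\<in>UNIV. s i * p i) * (\<Sum>i\<in>UNIV. t i * p i)) ^ n"
    using prob_space.expectation_kernel_poly[OF M X Y ind assms(3,5) n, of s t]
    by (simp add: vpow_def)
qed

end
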